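(* Let $q$ be a prime power, $1\le k\le n$, $\mathbb{F}=\mathbb{F}_q(Z_1,\dots,Z_n)$, and $G=\big(Z_j^{q^{i-1}}\big)_{i\in[k],j\in[n]}\in\mathbb{F}^{k\times n}$. For every generic kernel pattern $\mathcal{V}=(V_1,\dots,V_k)$ of $\mathbb{F}_q$-subspaces of $\mathbb{F}_q^n$ and every choice of matrices $A_1,\dots,A_k$ with $A_i\in\mathbb{F}_q^{n\times\dim V_i}$ and $\langle A_i\rangle=V_i$, there exists $M_{\mathcal{V}}\in\mathbb{F}^{k\times k}$ such that: (1) $M_{\mathcal{V}}$ is invertible; (2) $\bm{m}_iGA_i=0$ for all $i\in[k]$, where $\bm{m}_i$ is the $i$-th row of $M_{\mathcal{V}}$; (3) every entry of $M_{\mathcal{V}}$ is a polynomial in $Z_1,\dots,Z_n$ over $\mathbb{F}_q$ of degree at most $q^{k-1}$. In particular, the symbolic Gabidulin code $\mathcal{G}_{n,k}(Z_1,\dots,Z_n)$ (the $[n,k]_{\mathbb{F}}$ code with generator matrix $G$) is $\mathrm{GKP}(\ell)$ for all $\ell\ge1$.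
   Context: $Z_1,\dots,Z_n$ are independent indeterminates. $\langle A\rangle$ denotes the $\mathbb{F}_q$-column span of a matrix $A$ over $\mathbb{F}_q$. A kernel pattern is a tuple $(V_1,\dots,V_k)$ of $\mathbb{F}_q$-subspaces of $\mathbb{F}_q^n$; it is a generic kernel pattern if $\dim(\bigcap_{i\in\Omega}V_i)\le k-|\Omega|$ for all nonempty $\Omega\subseteq[k]$, and has order $\ell$ if exactly $\ell$ distinct nonzero subspaces occur among the $V_i$. For a field $\mathbb{F}\supseteq\mathbb{F}_q$, an $[n,k]_{\mathbb{F}}$ code $C$ with generator matrix $G$ ($C=\{G^T\bm{u}\}$) attains a kernel pattern if for full-rank $A_i$ with $\langle A_i\rangle=V_i$ there is an invertible $M$ with rows $\bm{m}_i$ with $\bm{m}_iGA_i=0$ for all $i$. $C$ is MRD if every nonzero codeword $\bm{v}$ has $\dim_{\mathbb{F}_q}\mathrm{span}_{\mathbb{F}_q}\{v_1,\dots,v_n\}\ge n-k+1$, and $C$ is $\mathrm{GKP}(\ell)$ if it is MRD and attains every generic kernel pattern of order at most $\ell$. *)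

theory Defs
  imports "HOL-Library.Poly_Mapping" "HOL-Computational_Algebra.Fraction_Field"
    "Jordan_Normal_Form.VS_Connect" "Jordan_Normal_Form.Determinant"
begin

text \<open>Polynomials over F_q in the indeterminates Z_0, Z_1, ... (Z_j is the variable with index j;
  the paper's Z_1..Z_n are our Z_0..Z_(n-1)).  Monomials are finitely supported exponent maps.\<close>
type_synonym 'a mpoly = "(nat \<Rightarrow>\<^sub>0 nat) \<Rightarrow>\<^sub>0 'a"
type_synonym 'a ratfun = "'a mpoly fract"

definition Zvar :: "nat \<Rightarrow> 'a::field mpoly" where
  "Zvar j = Poly_Mapping.single (Poly_Mapping.single j 1) 1"

definition const_poly :: "'a::field \<Rightarrow> 'a mpoly" where
  "const_poly c = Poly_Mapping.single 0 c"

definition vars :: "'a::zero mpoly \<Rightarrow> nat set" where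
  "vars p = (\<Union>m\<in>Poly_Mapping.keys p. Poly_Mapping.keys m)"

definition total_degree :: "'a::zero mpoly \<Rightarrow> nat" where
  "total_degree p = Max (insert 0 ((\<lambda>m. \<Sum>j\<in>Poly_Mapping.keys m. Poly_Mapping.lookup m j) ` Poly_Mapping.keys p))"

definition emb :: "'a::field \<Rightarrow> 'a ratfun" where
  "emb c = to_fract (const_poly c)"

text \<open>The field F = F_q(Z_1,...,Z_n), as a subfield of the fraction field of the
  polynomial ring in countably many variables.\<close>
definition ratfun_field :: "nat \<Rightarrow> 'a::field ratfun set" where
  "ratfun_field n = {Fract p r | p r. r \<noteq> 0 \<and> vars p \<subseteq> {..<n} \<and> vars r \<subseteq> {..<n}}"

definition fq_subspace :: "nat \<Rightarrow> 'a::field vec set \<Rightarrow> bool" where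
  "fq_subspace n W = subspace (class_ring :: 'a ring) W (module_vec TYPE('a) n)"

definition fq_dim :: "nat \<Rightarrow> 'a::field vec set \<Rightarrow> nat" where
  "fq_dim n W = vectorspace.dim (class_ring :: 'a ring) ((module_vec TYPE('a) n)\<lparr>carrier := W\<rparr>)"

definition col_span :: "nat \<Rightarrow> 'a::field mat \<Rightarrow> 'a vec set" where
  "col_span n A = LinearCombinations.module.span (class_ring :: 'a ring) (module_vec TYPE('a) n) (set (cols A))"

definition kernel_pattern :: "nat \<Rightarrow> nat \<Rightarrow> (nat \<Rightarrow> 'a::field vec set) \<Rightarrow> bool" where
  "kernel_pattern n k V = (\<forall>i<k. fq_subspace n (V i))"

definition generic_kernel_pattern :: "nat \<Rightarrow> nat \<Rightarrow> (nat \<Rightarrow> 'a::field vec set) \<Rightarrow> bool" where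
  "generic_kernel_pattern n k V \<longleftrightarrow> kernel_pattern n k V \<and>
     (\<forall>\<Omega>. \<Omega> \<subseteq> {..<k} \<and> \<Omega> \<noteq> {} \<longrightarrow> fq_dim n (\<Inter>i\<in>\<Omega>. V i) \<le> k - card \<Omega>)"

definition kp_order :: "nat \<Rightarrow> nat \<Rightarrow> (nat \<Rightarrow> 'a::field vec set) \<Rightarrow> nat" where
  "kp_order n k V = card (V ` {..<k} - {{0\<^sub>v n}})"

definition lift_mat :: "'a::field mat \<Rightarrow> 'a ratfun mat" where
  "lift_mat A = map_mat emb A"

definition in_F_mat :: "nat \<Rightarrow> 'a::field ratfun mat \<Rightarrow> bool" where
  "in_F_mat n M = (\<forall>i<dim_row M. \<forall>j<dim_col M. M $$ (i,j) \<in> ratfun_field n)"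

definition code_of :: "nat \<Rightarrow> nat \<Rightarrow> 'a::field ratfun mat \<Rightarrow> 'a ratfun vec set" where
  "code_of n k G = {transpose_mat G *\<^sub>v u | u. u \<in> carrier_vec k \<and> (\<forall>i<k. u $ i \<in> ratfun_field n)}"

definition fq_module :: "'a::field itself \<Rightarrow> ('a, 'a ratfun) module" where
  "fq_module _ = \<lparr>carrier = UNIV, mult = (*), one = 1, zero = 0, add = (+), smult = (\<lambda>c x. emb c * x)\<rparr>"

definition fq_rank :: "'a::field ratfun vec \<Rightarrow> nat" where
  "fq_rank v = vectorspace.dim (class_ring :: 'a ring)
      ((fq_module TYPE('a))\<lparr>carrier := LinearCombinations.module.span (class_ring :: 'a ring) (fq_module TYPE('a)) (set\<^sub>v v)\<rparr>)"

definition is_MRD :: "nat \<Rightarrow> nat \<Rightarrow> 'a::field ratfun mat \<Rightarrow> bool" where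
  "is_MRD n k G = (\<forall>v \<in> code_of n k G. v \<noteq> 0\<^sub>v n \<longrightarrow> fq_rank v \<ge> n - k + 1)"

definition attains :: "nat \<Rightarrow> nat \<Rightarrow> 'a::field ratfun mat \<Rightarrow> (nat \<Rightarrow> 'a vec set) \<Rightarrow> bool" where
  "attains n k G V \<longleftrightarrow>
     (\<forall>A. (\<forall>i<k. A i \<in> carrier_mat n (fq_dim n (V i)) \<and> col_span n (A i) = V i) \<longrightarrow>
        (\<exists>M \<in> carrier_mat k k. in_F_mat n M \<and> invertible_mat M \<and>
           (\<forall>i<k. mat_of_row (row M i) * G * lift_mat (A i) = 0\<^sub>m 1 (dim_col (A i)))))"

definition is_GKP :: "nat \<Rightarrow> nat \<Rightarrow> nat \<Rightarrow> 'a::field ratfun mat \<Rightarrow> bool" where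
  "is_GKP l n k G \<longleftrightarrow> is_MRD n k G \<and>
     (\<forall>V. generic_kernel_pattern n k V \<and> kp_order n k V \<le> l \<longrightarrow> attains n k G V)"

definition gab_matrix :: "'a::{finite,field} itself \<Rightarrow> nat \<Rightarrow> nat \<Rightarrow> 'a ratfun mat" where
  "gab_matrix _ k n = mat k n (\<lambda>(i,j). to_fract (Zvar j ^ (card (UNIV :: 'a set) ^ i)))"

end

(*
  A vector m is orthogonal to G A_i iff the q-linearized polynomial f with coefficients m vanishes on
  the F_q-space U_i of linear forms spanned by the columns of A_i, i.e. iff f lies in the span of the
  Frobenius powers F_i^(q^j), j < k - dim U_i, of F_i = PROD_{x in U_i} (X - x).  So one has to choose
  exponents j_i with the F_i^(q^j_i) linearly independent; their coefficients then form M, and the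
  degree bound is immediate.

  Fresh variables reduce this to dim U_i = k - 1.  There we prove more, for pairs (U_i, r_i): the
  families F_i^(q^j), j < s_i := k - dim U_i - r_i, are jointly independent as soon as
  sum_{i in Omega} s_i + dim (INT_{i in Omega} U_i) + min_{i in Omega} r_i <= k for all nonempty Omega.
  Here r_i is the order of vanishing at infinity.  Induction:
  - a proper Omega attaining equality is merged into the single pair (INT U_i, min r_i);
  - if at most one r_i is zero, only that family reaches the top degree, and k can be lowered;
  - otherwise there are r_1 = r_2 = 0 and a functional g that vanishes on U_1 but not on U_2.  Letting
    the variables go to infinity along g turns U_i into its intersection with ker g, increasing r_i
    when U_i is not contained in ker g.  Unlike specialising a variable to zero, this does not
    enlarge intersections.
*)
theory Submission
  imports Defs "HOL-Library.Cardinality" "Jordan_Normal_Form.Char_Poly"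
begin

section \<open>Frobenius powers and constants\<close>

text \<open>The cut by a functional g dictates the induction hypothesis. If U has a vector u outside
  ker g and H is its part inside, then F_U = F_H^q - F_H(u)^(q-1) F_H, and under Z_j -> Z_j + g(Z_j)
  T only the factor F_H(u)^(q-1) grows with T. In the limit the family keeps its length s but is
  built from H, so its top degree drops by a factor q; r records this, and s + dim + r stays equal
  to k. The danger is an intersection already inside ker g: its dimension stays while the minimum of
  r may rise by one. A strict inequality absorbs this, which is why sets with equality are merged
  first; the whole index set is protected by U_1, whose r stays 0. Merging works because equality
  makes sum s_i exactly the number of Frobenius powers of F for the intersection whose span contains
  all families of the set. It may produce s > 1, so a single power per subspace would be too weak an
  induction hypothesis. Fresh variables are removed again because F for U + F_q w is F_U^q - c F_U:
  if neither term could take its place, neither could the difference.\<close>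

lemma card_ge_1: "1 \<le> CARD('a::finite)"
  using finite_UNIV_card_ge_0[where 'a='a] by simp

text \<open>Multiplication by a nonzero \<open>x\<close> permutes the units, so their product P
  satisfies x^(q-1) P = P.\<close>

lemma card_field_power:
  fixes x :: "'a::{finite,field}"
  shows "x ^ CARD('a) = x"
proof (cases "x = 0")
  case False
  have "(\<Prod>y\<in>UNIV-{0}. x * y) = (\<Prod>y\<in>UNIV-{0}. y)"
    by (rule prod.reindex_bij_witness[of _ "\<lambda>y. y / x" "\<lambda>y. x * y"]) (use False in auto)
  then have "x ^ (CARD('a) - 1) * \<Prod>(UNIV-{0}) = 1 * \<Prod>(UNIV-{0::'a})"
    by (simp add: prod.distrib)
  then have "x ^ (CARD('a) - 1) = 1"
    by (subst (asm) mult_right_cancel) auto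
  then show ?thesis
    using finite_UNIV_card_ge_0[where ?'a = 'a] power_Suc[of x "CARD('a) - 1"] by simp
qed (use finite_UNIV_card_ge_0[where ?'a = 'a] in auto)

text \<open>The middle binomial terms form a polynomial of degree below q that vanishes at all q
  field elements, because (x + 1)^q = x + 1 = x^q + 1. Hence it is zero, with no appeal to the
  characteristic.\<close>

lemma of_nat_choose_card_eq_0:
  assumes "0 < i" "i < CARD('a::{finite,field})"
  shows "of_nat (CARD('a) choose i) = (0::'a)"
proof -
  let ?q = "CARD('a)"
  define p :: "'a poly" where "p = (\<Sum>j\<in>{1..<?q}. monom (of_nat (?q choose j)) j)"
  have q1: "1 \<le> ?q" by (rule card_ge_1)
  have fermat: "x ^ ?q = x" for x :: 'a
    by (rule card_field_power)
  have "poly p x = 0" for x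
  proof -
    have "1 + x = (x + 1) ^ ?q" by (simp add: fermat)
    also have "\<dots> = (\<Sum>j\<le>?q. of_nat (?q choose j) * x ^ j)" by (simp add: binomial_ring)
    also have "{..?q} = insert 0 (insert ?q {1..<?q})" using q1 by auto
    also have "(\<Sum>j\<in>\<dots>. of_nat (?q choose j) * x ^ j) = 1 + (x ^ ?q + (\<Sum>j\<in>{1..<?q}. of_nat (?q choose j) * x ^ j))"
      using q1 by (subst sum.insert; simp)
    also have "(\<Sum>j\<in>{1..<?q}. of_nat (?q choose j) * x ^ j) = poly p x"
      by (simp add: p_def poly_sum poly_monom)
    finally show ?thesis by (simp add: fermat)
  qed
  moreover have "degree p < ?q"
    unfolding p_def using q1
    by (intro degree_sum_less) (auto intro: le_less_trans[OF degree_monom_le])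
  ultimately have "p = 0"
    by (intro poly_eqI_degree[of UNIV]) (auto simp: q1 finite_UNIV_card_ge_0)
  moreover have "coeff p i = of_nat (?q choose i)"
    using assms by (simp add: p_def coeff_sum)
  ultimately show ?thesis by simp
qed

text \<open>The assumption says that every natural number vanishing in F_q vanishes in the target
  ring. In this form the lemma serves \<open>mpoly\<close> and the polynomial rings stacked on top
  of it.\<close>

lemma power_card_add:
  fixes x y :: "'b::comm_ring_1"
  assumes "\<And>m. of_nat m = (0::'a::{finite,field}) \<Longrightarrow> of_nat m = (0::'b)"
  shows "(x + y) ^ (CARD('a) ^ j) = x ^ (CARD('a) ^ j) + y ^ (CARD('a) ^ j)"
proof -
  let ?q = "CARD('a)"
  have q1: "1 \<le> ?q" by (rule card_ge_1)
  have *: "(x + y) ^ ?q = x ^ ?q + y ^ ?q" for x y :: 'b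
  proof -
    have "(x + y) ^ ?q = (\<Sum>j\<le>?q. of_nat (?q choose j) * x ^ j * y ^ (?q - j))"
      by (simp add: binomial_ring)
    also have "{..?q} = insert 0 (insert ?q {1..<?q})" using q1 by auto
    also have "(\<Sum>j\<in>\<dots>. of_nat (?q choose j) * x ^ j * y ^ (?q - j))
       = y ^ ?q + (x ^ ?q + (\<Sum>j\<in>{1..<?q}. of_nat (?q choose j) * x ^ j * y ^ (?q - j)))"
      using q1 by (subst sum.insert; simp)
    also have "(\<Sum>j\<in>{1..<?q}. of_nat (?q choose j) * x ^ j * y ^ (?q - j)) = 0"
      using of_nat_choose_card_eq_0[where 'a='a] assms by (intro sum.neutral) auto
    finally show ?thesis by simp
  qed
  show ?thesis
    by (induction j arbitrary: x y) (simp_all add: power_mult *)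
qed

lemma of_nat_mpoly_eq_0:
  assumes "of_nat m = (0::'a::field)"
  shows "of_nat m = (0::'a mpoly)"
  using assms by (metis single_of_nat single_zero)

lemma mpoly_power_card_add:
  fixes x y :: "'a::{finite,field} mpoly"
  shows "(x + y) ^ (CARD('a) ^ j) = x ^ (CARD('a) ^ j) + y ^ (CARD('a) ^ j)"
  by (rule power_card_add) (rule of_nat_mpoly_eq_0)

lemma mpoly_poly_power_card_add:
  fixes x y :: "'a::{finite,field} mpoly poly"
  shows "(x + y) ^ (CARD('a) ^ j) = x ^ (CARD('a) ^ j) + y ^ (CARD('a) ^ j)"
  by (rule power_card_add) (metis of_nat_mpoly_eq_0 of_nat_poly pCons_0_0)

lemma const_poly_simps [simp]:
  "const_poly (0::'a::field) = 0" "const_poly (1::'a) = 1"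
  "const_poly (a + b) = const_poly (a::'a) + const_poly b"
  "const_poly (a * b) = const_poly a * const_poly b"
  "const_poly (- a) = - const_poly a"
  "const_poly (a - b) = const_poly a - const_poly b"
  by (simp_all add: const_poly_def single_add single_uminus single_diff mult_single)

lemma const_poly_power [simp]: "const_poly ((a::'a::field) ^ n) = const_poly a ^ n"
  by (induction n) simp_all

lemma const_poly_eq_iff [simp]: "const_poly (a::'a::field) = const_poly b \<longleftrightarrow> a = b"
  by (metis const_poly_def lookup_single_eq)

lemma const_poly_eq_0_iff [simp]: "const_poly (a::'a::field) = 0 \<longleftrightarrow> a = 0"
  using const_poly_eq_iff[of a 0] by (simp del: const_poly_eq_iff)

lemma const_poly_power_card [simp]: "const_poly (c::'a::{finite,field}) ^ (CARD('a) ^ j) = const_poly c"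
proof (induction j)
  case (Suc j)
  then show ?case
    using card_field_power[of c] by (simp add: power_mult power_Suc2 del: power_Suc const_poly_power flip: const_poly_power)
qed simp

interpretation Fq: vector_space "\<lambda>(c::'a::field) x. const_poly c * (x :: 'a mpoly)"
  by unfold_locales (simp_all add: algebra_simps)

section \<open>Vanishing polynomials of subspaces\<close>

text \<open>The subspace polynomial F of the overview when \<open>S\<close> is a finite
  F_q-subspace.\<close>

definition vanishing_poly :: "'b::comm_ring_1 set \<Rightarrow> 'b poly" where
  "vanishing_poly S = (\<Prod>x\<in>S. [:- x, 1:])"

lemma poly_vanishing_poly_eq_0: "finite S \<Longrightarrow> x \<in> S \<Longrightarrow> poly (vanishing_poly S) x = 0"
  by (auto simp: vanishing_poly_def poly_prod intro!: prod_zero bexI[of _ x])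

lemma monic_vanishing_poly: "lead_coeff (vanishing_poly (S::'b::idom set)) = 1"
  by (simp add: vanishing_poly_def lead_coeff_prod)

lemma vanishing_poly_neq_0 [simp]: "vanishing_poly (S::'b::idom set) \<noteq> 0"
  using monic_vanishing_poly[of S] by auto

lemma degree_vanishing_poly: "degree (vanishing_poly (S::'b::idom set)) = card S"
  unfolding vanishing_poly_def by (subst degree_prod_eq_sum_degree) auto

text \<open>Linearized (Ore) polynomials, described by their exponents so that coefficients can be
  read off at powers of q.\<close>

definition q_linear :: "'a::{finite,field} mpoly poly \<Rightarrow> bool" where
  "q_linear p \<longleftrightarrow> (\<forall>e. coeff p e \<noteq> 0 \<longrightarrow> (\<exists>s. e = CARD('a) ^ s))"

lemma q_linear_poly_add:
  assumes "q_linear p"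
  shows "poly p (x + y) = poly p x + poly p y"
proof -
  have "coeff p e * (x + y) ^ e = coeff p e * x ^ e + coeff p e * y ^ e" for e
    using assms by (cases "coeff p e = 0") (auto simp: q_linear_def mpoly_power_card_add algebra_simps)
  then show ?thesis by (simp add: poly_altdef sum.distrib)
qed

lemma q_linear_poly_scale:
  assumes "q_linear p"
  shows "poly p (const_poly c * x) = const_poly c * poly p x"
proof -
  have "coeff p e * (const_poly c * x) ^ e = const_poly c * (coeff p e * x ^ e)" for e
    using assms by (cases "coeff p e = 0") (auto simp: q_linear_def power_mult_distrib)
  then show ?thesis by (simp only: poly_altdef sum_distrib_left)
qed

lemma q_linear_diff: "q_linear p \<Longrightarrow> q_linear r \<Longrightarrow> q_linear (p - r)"
  by (force simp: q_linear_def)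

lemma q_linear_smult: "q_linear p \<Longrightarrow> q_linear (Polynomial.smult c p)"
  by (auto simp: q_linear_def)

lemma sum_mpoly_poly_power_card:
  fixes f :: "'i \<Rightarrow> 'a::{finite,field} mpoly poly"
  shows "finite I \<Longrightarrow> (\<Sum>i\<in>I. f i) ^ (CARD('a) ^ j) = (\<Sum>i\<in>I. f i ^ (CARD('a) ^ j))"
  by (induction I rule: finite_induct) (simp_all add: mpoly_poly_power_card_add card_gt_0_iff)

lemma q_linear_power:
  fixes p :: "'a::{finite,field} mpoly poly"
  assumes "q_linear p"
  shows "q_linear (p ^ (CARD('a) ^ j))"
proof -
  let ?q = "CARD('a) ^ j"
  have "p = (\<Sum>e\<le>degree p. monom (coeff p e) e)" by (rule poly_as_sum_of_monoms[symmetric])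
  then have "p ^ ?q = (\<Sum>e\<le>degree p. monom (coeff p e) e ^ ?q)"
    by (metis (no_types, lifting) sum_mpoly_poly_power_card finite_atMost sum.cong)
  then have *: "p ^ ?q = (\<Sum>e\<le>degree p. monom (coeff p e ^ ?q) (e * ?q))"
    by (simp add: monom_power)
  show ?thesis
    unfolding q_linear_def
  proof (intro allI impI)
    fix e assume "coeff (p ^ ?q) e \<noteq> 0"
    then obtain e' where e': "coeff (monom (coeff p e' ^ ?q) (e' * ?q)) e \<noteq> 0"
      unfolding * coeff_sum by (meson sum.neutral)
    then have "e = e' * ?q" "coeff p e' \<noteq> 0"
      by (auto split: if_splits simp: card_gt_0_iff)
    with assms show "\<exists>s. e = CARD('a) ^ s"
      unfolding q_linear_def by (metis power_add)
  qed
qed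

section \<open>Extending a subspace by one vector, and the recursion for subspace
  polynomials\<close>

definition adjoin :: "'a::field mpoly set \<Rightarrow> 'a mpoly \<Rightarrow> 'a mpoly set" where
  "adjoin H u = (\<lambda>(h, c). h + const_poly c * u) ` (H \<times> UNIV)"

lemma adjoin_inj:
  assumes "Fq.subspace H" "u \<notin> H"
  shows "inj_on (\<lambda>(h, c). h + const_poly c * u) (H \<times> UNIV)"
proof (rule inj_onI, clarify)
  fix h c h' c'
  assume H: "h \<in> H" "h' \<in> H" and eq: "h + const_poly c * u = h' + const_poly c' * u"
  have eq': "const_poly (c - c') * u = h' - h"
    using arg_cong[OF eq, of "\<lambda>z. z - h - const_poly c' * u"] by (simp add: left_diff_distrib)
  have "c = c'"
  proof (rule ccontr)
    assume "c \<noteq> c'"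
    then have "u = const_poly (inverse (c - c')) * (const_poly (c - c') * u)"
      by (simp flip: const_poly_simps mult.assoc)
    also have "\<dots> \<in> H"
      unfolding eq' using assms H by (intro Fq.subspace_scale Fq.subspace_diff) auto
    finally show False using assms by simp
  qed
  with eq show "h = h' \<and> c = c'" by simp
qed

lemma card_adjoin:
  fixes H :: "'a::{finite,field} mpoly set"
  assumes "Fq.subspace H" "u \<notin> H"
  shows "card (adjoin H u) = CARD('a) * card H"
  unfolding adjoin_def using adjoin_inj[OF assms]
  by (simp add: card_image card_cartesian_product mult.commute)

lemma subspace_adjoin:
  assumes "Fq.subspace H"
  shows "Fq.subspace (adjoin H u)"
proof (rule Fq.subspaceI)
  show "0 \<in> adjoin H u"
    unfolding adjoin_def using Fq.subspace_0[OF assms] by (intro image_eqI[of _ _ "(0, 0)"]) auto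
next
  fix x y assume "x \<in> adjoin H u" "y \<in> adjoin H u"
  then obtain h c h' c' where "h \<in> H" "h' \<in> H" "x = h + const_poly c * u" "y = h' + const_poly c' * u"
    by (auto simp: adjoin_def)
  then show "x + y \<in> adjoin H u"
    unfolding adjoin_def using Fq.subspace_add[OF assms]
    by (intro image_eqI[of _ _ "(h + h', c + c')"]) (auto simp: algebra_simps)
next
  fix d x assume "x \<in> adjoin H u"
  then obtain h c where "h \<in> H" "x = h + const_poly c * u"
    by (auto simp: adjoin_def)
  then show "const_poly d * x \<in> adjoin H u"
    unfolding adjoin_def using Fq.subspace_scale[OF assms]
    by (intro image_eqI[of _ _ "(const_poly d * h, d * c)"]) (auto simp: algebra_simps)
qed

lemma finite_adjoin: "finite (H::'a::{finite,field} mpoly set) \<Longrightarrow> finite (adjoin H u)"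
  by (simp add: adjoin_def)

lemma subset_adjoin: "H \<subseteq> adjoin H u"
  by (force simp: adjoin_def intro!: image_eqI[of _ _ "(_, 0)"])

lemma mem_adjoin: "Fq.subspace H \<Longrightarrow> u \<in> adjoin H u"
  using Fq.subspace_0[of H] by (force simp: adjoin_def intro!: image_eqI[of _ _ "(0, 1)"])

lemma adjoin_subset: "Fq.subspace U \<Longrightarrow> H \<subseteq> U \<Longrightarrow> u \<in> U \<Longrightarrow> adjoin H u \<subseteq> U"
  by (auto simp: adjoin_def intro!: Fq.subspace_add Fq.subspace_scale)

text \<open>Builds \<open>U\<close> from \<open>U0\<close> one vector at a time. The start is a
  general \<open>U0\<close> and not only 0, since \<open>vanishing_poly_mem_qspan\<close> compares
  two nested spaces.\<close>

lemma subspace_interval_induct [consumes 4, case_names base adjoin]: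
  fixes U :: "'a::{finite,field} mpoly set"
  assumes "finite U" "Fq.subspace U" "Fq.subspace U0" "U0 \<subseteq> U"
  assumes base: "P U0"
  assumes step: "\<And>H u. U0 \<subseteq> H \<Longrightarrow> H \<subseteq> U \<Longrightarrow> Fq.subspace H \<Longrightarrow> u \<in> U \<Longrightarrow> u \<notin> H \<Longrightarrow> P H \<Longrightarrow> P (adjoin H u)"
  shows "P U"
proof -
  have "P U" if "Fq.subspace H" "U0 \<subseteq> H" "H \<subseteq> U" "P H" for H
    using that
  proof (induction "card U - card H" arbitrary: H rule: less_induct)
    case less
    show ?case
    proof (cases "H = U")
      case False
      then obtain u where u: "u \<in> U" "u \<notin> H" using less.prems by auto
      have fin: "finite (adjoin H u)" using finite_adjoin less.prems \<open>finite U\<close> finite_subset by blast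
      have sub: "adjoin H u \<subseteq> U" using adjoin_subset assms less.prems u by blast
      have "H \<subset> adjoin H u"
        using subset_adjoin mem_adjoin less.prems u by blast
      then have "card H < card (adjoin H u)" using fin psubset_card_mono by blast
      moreover have "card (adjoin H u) \<le> card U" using sub \<open>finite U\<close> card_mono by blast
      ultimately show ?thesis
        using less.prems u sub subset_adjoin[of H u] subspace_adjoin step assms(1)
        by (intro less.hyps[of "adjoin H u"]) auto
    qed (use less in simp)
  qed
  then show ?thesis using assms by blast
qed

text \<open>Both sides are monic of degree q |H|, so agreement on the q |H| points of
  \<open>adjoin H u\<close> suffices. At h + c u the polynomial F_H takes the value c F_H(u), and
  c^q = c makes the right side vanish.\<close>

lemma vanishing_poly_adjoin:
  fixes H :: "'a::{finite,field} mpoly set"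
  assumes "finite H" "Fq.subspace H" "u \<notin> H" and lin: "q_linear (vanishing_poly H)"
  shows "vanishing_poly (adjoin H u) =
    vanishing_poly H ^ CARD('a) - Polynomial.smult (poly (vanishing_poly H) u ^ (CARD('a) - 1)) (vanishing_poly H)"
    (is "_ = ?r")
proof (rule poly_eqI_degree_lead_coeff[where n = "CARD('a) * card H" and A = "adjoin H u"])
  let ?F = "vanishing_poly H"
  have "0 \<in> H" using assms Fq.subspace_0 by auto
  then have h: "0 < card H" using assms by (auto simp: card_gt_0_iff)
  have "card {0::'a, 1} \<le> CARD('a)" by (intro card_mono) auto
  then have q: "2 \<le> CARD('a)" by simp
  have deg: "degree (?F ^ CARD('a)) = CARD('a) * card H"
    by (simp add: degree_power_eq degree_vanishing_poly)
  have lt: "card H < CARD('a) * card H" using q h by simp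
  show "degree (vanishing_poly (adjoin H u)) \<le> CARD('a) * card H"
    using assms by (simp add: degree_vanishing_poly card_adjoin)
  show "card (adjoin H u) \<ge> CARD('a) * card H"
    using assms by (simp add: card_adjoin)
  have "degree (Polynomial.smult (poly ?F u ^ (CARD('a) - 1)) ?F) \<le> card H"
    by (metis degree_smult_le degree_vanishing_poly)
  then show "degree ?r \<le> CARD('a) * card H"
    using deg lt by (intro degree_diff_le) linarith+
  have "coeff ?r (CARD('a) * card H) = 1"
    using deg lt monic_vanishing_poly[of H] lead_coeff_power[of ?F "CARD('a)"]
    by (simp add: coeff_eq_0 degree_vanishing_poly)
  moreover have "coeff (vanishing_poly (adjoin H u)) (CARD('a) * card H) = 1"
    using monic_vanishing_poly[of "adjoin H u"] assms by (simp add: degree_vanishing_poly card_adjoin)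
  ultimately show "coeff (vanishing_poly (adjoin H u)) (CARD('a) * card H) = coeff ?r (CARD('a) * card H)"
    by simp
next
  fix z assume z: "z \<in> adjoin H u"
  let ?F = "vanishing_poly H"
  obtain h c where hc: "h \<in> H" "z = h + const_poly c * u" using z by (auto simp: adjoin_def)
  have F: "poly ?F z = const_poly c * poly ?F u"
    using hc assms by (simp add: q_linear_poly_add q_linear_poly_scale poly_vanishing_poly_eq_0)
  have "poly ?F u ^ (CARD('a) - 1) * poly ?F u = poly ?F u ^ CARD('a)"
    by (metis power_minus_mult zero_less_card_finite)
  then have "poly ?r z = 0"
    using const_poly_power_card[of c 1]
    by (simp add: F power_mult_distrib)
  then show "poly (vanishing_poly (adjoin H u)) z = poly ?r z"
    using assms z by (simp add: poly_vanishing_poly_eq_0 finite_adjoin)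
qed

lemma q_linear_vanishing_poly:
  fixes U :: "'a::{finite,field} mpoly set"
  assumes "finite U" "Fq.subspace U"
  shows "q_linear (vanishing_poly U)"
proof -
  have "{0} \<subseteq> U" using assms Fq.subspace_0 by auto
  from assms Fq.subspace_single_0 this show ?thesis
  proof (induction U rule: subspace_interval_induct)
    case base
    have "e = CARD('a) ^ 0" if "coeff (vanishing_poly {0::'a mpoly}) e \<noteq> 0" for e
      using that by (auto simp: vanishing_poly_def coeff_pCons split: nat.splits)
    then show ?case unfolding q_linear_def by blast
  next
    case (adjoin H u)
    then have "finite H" using assms finite_subset by blast
    with adjoin show ?case
      using q_linear_power[of "vanishing_poly H" 1]
      by (auto simp: vanishing_poly_adjoin intro!: q_linear_diff q_linear_smult)
  qed
qed

lemma card_subspace: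
  fixes U :: "'a::{finite,field} mpoly set"
  assumes "finite U" "Fq.subspace U"
  obtains d where "card U = CARD('a) ^ d"
proof -
  have "{0} \<subseteq> U" using assms Fq.subspace_0 by auto
  from assms Fq.subspace_single_0 this have "\<exists>d. card U = CARD('a) ^ d"
  proof (induction U rule: subspace_interval_induct)
    case base
    show ?case by (rule exI[of _ 0]) simp
  next
    case (adjoin H u)
    then show ?case by (metis card_adjoin power_Suc)
  qed
  with that show ?thesis by blast
qed

section \<open>Evaluation of polynomials\<close>

definition eval_mpoly :: "('a::field \<Rightarrow> 'b::comm_ring_1) \<Rightarrow> (nat \<Rightarrow> 'b) \<Rightarrow> 'a mpoly \<Rightarrow> 'b" where
  "eval_mpoly e z p = (\<Sum>m\<in>Poly_Mapping.keys p. e (Poly_Mapping.lookup p m) *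
     (\<Prod>j\<in>Poly_Mapping.keys m. z j ^ Poly_Mapping.lookup m j))"

lemma mpoly_induct [case_names zero add]:
  assumes "P 0" and "\<And>p m c. P p \<Longrightarrow> P (Poly_Mapping.single m c + p)"
  shows "P (p :: 'a::field mpoly)"
proof (induction p rule: Poly_Mapping.update_induct)
  case (update f a b)
  then have "Poly_Mapping.update a b f = Poly_Mapping.single a b + f"
    by (intro poly_mapping_eqI) (auto simp: lookup_update lookup_add lookup_single in_keys_iff when_def)
  with update assms(2) show ?case by simp
qed (use assms in simp)

lemma prod_keys_power_add:
  fixes z :: "nat \<Rightarrow> 'b::comm_ring_1"
  shows "(\<Prod>j\<in>Poly_Mapping.keys (m + m'). z j ^ Poly_Mapping.lookup (m + m') j) =
    (\<Prod>j\<in>Poly_Mapping.keys m. z j ^ Poly_Mapping.lookup m j) *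
    (\<Prod>j\<in>Poly_Mapping.keys m'. z j ^ Poly_Mapping.lookup m' j)"
proof -
  let ?S = "Poly_Mapping.keys m \<union> Poly_Mapping.keys m'"
  have *: "(\<Prod>j\<in>Poly_Mapping.keys l. z j ^ Poly_Mapping.lookup l j) = (\<Prod>j\<in>?S. z j ^ Poly_Mapping.lookup l j)"
    if "Poly_Mapping.keys l \<subseteq> ?S" for l
    using that by (intro prod.mono_neutral_left) (auto simp: in_keys_iff)
  show ?thesis
    using keys_add[of m m'] by (subst (1 2 3) *) (simp_all add: lookup_add power_add prod.distrib)
qed

locale mpoly_eval =
  fixes e :: "'a::field \<Rightarrow> 'b::comm_ring_1" and z :: "nat \<Rightarrow> 'b"
  assumes e_0: "e 0 = 0" and e_1: "e 1 = 1"
    and e_add: "e (a + b) = e a + e b" and e_mult: "e (a * b) = e a * e b"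
begin

lemma eval_mpoly_single:
  "eval_mpoly e z (Poly_Mapping.single m c) = e c * (\<Prod>j\<in>Poly_Mapping.keys m. z j ^ Poly_Mapping.lookup m j)"
  by (simp add: eval_mpoly_def e_0)

lemma eval_mpoly_0: "eval_mpoly e z 0 = 0"
  by (simp add: eval_mpoly_def)

lemma eval_mpoly_add: "eval_mpoly e z (p + r) = eval_mpoly e z p + eval_mpoly e z r"
  unfolding eval_mpoly_def
  by (rule setsum_keys_plus_distrib) (simp_all add: e_0 e_add algebra_simps)

lemma eval_mpoly_mult: "eval_mpoly e z (p * r) = eval_mpoly e z p * eval_mpoly e z r"
proof (induction p rule: mpoly_induct)
  case (add p m c)
  have "eval_mpoly e z (Poly_Mapping.single m c * r) = eval_mpoly e z (Poly_Mapping.single m c) * eval_mpoly e z r"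
  proof (induction r rule: mpoly_induct)
    case (add r m' c')
    then show ?case
      by (simp add: distrib_left eval_mpoly_add mult_single eval_mpoly_single prod_keys_power_add e_mult mult_ac)
  qed (simp add: eval_mpoly_0)
  with add show ?case by (simp add: eval_mpoly_add distrib_right)
qed (simp add: eval_mpoly_0)

lemma eval_mpoly_const: "eval_mpoly e z (const_poly c) = e c"
  by (simp add: const_poly_def eval_mpoly_single)

lemma eval_mpoly_Zvar: "eval_mpoly e z (Zvar j) = z j"
  by (simp add: Zvar_def eval_mpoly_single e_1)

lemma eval_mpoly_hom: "comm_ring_hom (eval_mpoly e z)"
  by unfold_locales
    (simp_all add: eval_mpoly_0 eval_mpoly_add eval_mpoly_mult eval_mpoly_const e_1 flip: const_poly_simps(2))

end

lemma Zvar_power: "Zvar j ^ n = Poly_Mapping.single (Poly_Mapping.single j n) (1::'a::field)"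
  by (induction n) (simp_all add: Zvar_def mult_single flip: single_add)

lemma eval_mpoly_id: "eval_mpoly const_poly Zvar p = (p :: 'a::field mpoly)"
proof (induction p rule: mpoly_induct)
  interpret mpoly_eval const_poly "Zvar :: nat \<Rightarrow> 'a mpoly" by unfold_locales simp_all
  case (add p m c)
  have "(\<Prod>j\<in>S. Zvar j ^ Poly_Mapping.lookup m j) =
      Poly_Mapping.single (\<Sum>j\<in>S. Poly_Mapping.single j (Poly_Mapping.lookup m j)) (1::'a)" if "finite S" for S
    using that by (induction S rule: finite_induct) (simp_all add: Zvar_power mult_single)
  moreover have "(\<Sum>j\<in>Poly_Mapping.keys m. Poly_Mapping.single j (Poly_Mapping.lookup m j)) = m"
    by (intro poly_mapping_eqI) (auto simp: lookup_sum lookup_single when_def in_keys_iff)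
  ultimately have "eval_mpoly const_poly Zvar (Poly_Mapping.single m c) = const_poly c * Poly_Mapping.single m 1"
    by (simp add: eval_mpoly_single)
  also have "\<dots> = Poly_Mapping.single m c"
    by (simp add: const_poly_def mult_single)
  finally show ?case
    using add by (simp add: eval_mpoly_add)
qed (simp add: eval_mpoly_def)

text \<open>The variable T of the outer polynomial is the parameter sent to infinity; passing to the
  limit means reading off the highest coefficient in T.\<close>

definition shift_hom :: "('a::field mpoly \<Rightarrow> 'a) \<Rightarrow> 'a mpoly \<Rightarrow> 'a mpoly poly" where
  "shift_hom g = eval_mpoly (\<lambda>c. [:const_poly c:]) (\<lambda>j. [:Zvar j, const_poly (g (Zvar j)):])"

definition linear_forms :: "'a::field mpoly set" where
  "linear_forms = Fq.span (range Zvar)"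

locale Fq_functional =
  fixes g :: "'a::{finite,field} mpoly \<Rightarrow> 'a"
  assumes g_add: "g (x + y) = g x + g y" and g_scale: "g (const_poly c * x) = c * g x"
begin

sublocale shift: mpoly_eval "\<lambda>c. [:const_poly c:]" "\<lambda>j. [:Zvar j, const_poly (g (Zvar j)):]"
  by unfold_locales (simp_all add: one_pCons)

sublocale shift: comm_ring_hom "shift_hom g"
  unfolding shift_hom_def by (rule shift.eval_mpoly_hom)

lemma g_0 [simp]: "g 0 = 0"
  using g_scale[of 0 0] by simp

text \<open>Setting T = 0 undoes the shift, whence its injectivity: nonzero coefficients of a
  relation stay nonzero.\<close>

lemma poly_shift_hom_0: "poly (shift_hom g p) 0 = p"
proof -
  have "poly (shift_hom g p) 0 = eval_mpoly const_poly Zvar p"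
    by (simp add: shift_hom_def eval_mpoly_def poly_sum poly_prod)
  then show ?thesis by (simp add: eval_mpoly_id)
qed

lemma shift_hom_eq_0_iff [simp]: "shift_hom g p = 0 \<longleftrightarrow> p = 0"
  using poly_shift_hom_0[of p] by auto

lemma shift_hom_linear_form:
  assumes "x \<in> linear_forms"
  shows "shift_hom g x = [:x, const_poly (g x):]"
  using assms unfolding linear_forms_def
proof (induction x rule: Fq.span_induct_alt)
  case base
  then show ?case by simp
next
  case (step c x y)
  then show ?case
    by (auto simp: shift.hom_add shift.hom_mult g_add g_scale)
      (auto simp: shift_hom_def shift.eval_mpoly_const shift.eval_mpoly_Zvar)
qed

end

section \<open>Independence and degeneration to infinity\<close>

text \<open>Coefficients come from the polynomial ring; clearing denominators shows that this is
  independence over its fraction field.\<close>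

definition family_indep :: "'i set \<Rightarrow> ('i \<Rightarrow> 'a::{finite,field} mpoly set) \<Rightarrow> ('i \<Rightarrow> nat) \<Rightarrow> bool" where
  "family_indep I U s \<longleftrightarrow>
    (\<forall>a. (\<Sum>i\<in>I. \<Sum>j<s i. Polynomial.smult (a i j) (vanishing_poly (U i) ^ (CARD('a) ^ j))) = 0 \<longrightarrow>
       (\<forall>i\<in>I. \<forall>j<s i. a i j = 0))"

lemma pCons_0_hom: "comm_ring_hom (\<lambda>x::'b::comm_ring_1. [:x:])"
  by unfold_locales (simp_all add: one_pCons)

lemma mpoly_poly_poly_power_card_diff:
  fixes x y :: "'a::{finite,field} mpoly poly poly"
  shows "(x - y) ^ (CARD('a) ^ j) = x ^ (CARD('a) ^ j) - y ^ (CARD('a) ^ j)"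
proof -
  have "(x - y + y) ^ (CARD('a) ^ j) = (x - y) ^ (CARD('a) ^ j) + y ^ (CARD('a) ^ j)"
    by (rule power_card_add) (simp add: of_nat_poly of_nat_mpoly_eq_0)
  then show ?thesis by (simp add: algebra_simps)
qed

lemma (in comm_ring_hom) map_poly_vanishing_poly:
  "map_poly hom (vanishing_poly S) = (\<Prod>x\<in>S. [:- hom x, 1:])"
proof -
  interpret mp: map_poly_comm_ring_hom hom ..
  show ?thesis by (simp add: vanishing_poly_def mp.hom_prod hom_uminus)
qed

lemma card_UNIV_ge_2: "2 \<le> CARD('a::{finite,field})"
proof -
  have "card {0::'a, 1} \<le> CARD('a)" by (intro card_mono) auto
  then show ?thesis by simp
qed

section \<open>Degeneration along a linear functional\<close>

context Fq_functional
begin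

definition ker :: "'a mpoly set" where "ker = {x. g x = 0}"

lemma subspace_ker: "Fq.subspace ker"
  by (rule Fq.subspaceI) (auto simp: ker_def g_add g_scale)

lemma adjoin_ker:
  assumes "Fq.subspace U" "u \<in> U" "u \<notin> ker"
  shows "U = adjoin (U \<inter> ker) u"
proof
  show "adjoin (U \<inter> ker) u \<subseteq> U" using assms by (intro adjoin_subset) auto
  show "U \<subseteq> adjoin (U \<inter> ker) u"
  proof
    fix x assume x: "x \<in> U"
    define c where "c = g x / g u"
    have "x - const_poly c * u \<in> U" using assms x by (intro Fq.subspace_diff Fq.subspace_scale)
    moreover have "g (x - const_poly c * u) + g (const_poly c * u) = g x"
      by (simp flip: g_add)
    then have "x - const_poly c * u \<in> ker"
      using assms by (simp add: ker_def g_scale c_def)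
    ultimately show "x \<in> adjoin (U \<inter> ker) u"
      unfolding adjoin_def by (intro image_eqI[of _ _ "(x - const_poly c * u, c)"]) auto
  qed
qed

lemma map_poly_shift_hom_vanishing_poly:
  assumes "U \<subseteq> linear_forms" "U \<subseteq> ker"
  shows "map_poly (shift_hom g) (vanishing_poly U) = map_poly (\<lambda>x. [:x:]) (vanishing_poly U)"
proof -
  interpret c: comm_ring_hom "\<lambda>x::'a mpoly. [:x:]" by (rule pCons_0_hom)
  have "shift_hom g x = [:x:]" if "x \<in> U" for x
  proof -
    have "x \<in> linear_forms" "g x = 0" using assms that unfolding ker_def by blast+
    then show ?thesis by (simp add: shift_hom_linear_form)
  qed
  then show ?thesis
    by (simp add: shift.map_poly_vanishing_poly c.map_poly_vanishing_poly)
qed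

text \<open>The substitution \<open>Z\<^sub>j \<mapsto> Z\<^sub>j + g(Z\<^sub>j) T\<close> fixes the kernel of \<open>g\<close>, so in the highest power
  of \<open>T\<close> the polynomial of \<open>U\<close> is replaced by that of \<open>U \<inter> ker\<close>.\<close>
lemma family_indep_ker:
  assumes "finite I"
    and U: "\<And>i. i \<in> I \<Longrightarrow> finite (U i)" "\<And>i. i \<in> I \<Longrightarrow> Fq.subspace (U i)" "\<And>i. i \<in> I \<Longrightarrow> U i \<subseteq> linear_forms"
    and indep: "family_indep I (\<lambda>i. U i \<inter> ker) s"
  shows "family_indep I U s"
  unfolding family_indep_def
proof (intro allI impI, rule ccontr)
  fix a
  assume rel: "(\<Sum>i\<in>I. \<Sum>j<s i. Polynomial.smult (a i j) (vanishing_poly (U i) ^ (CARD('a) ^ j))) = 0"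
    and "\<not> (\<forall>i\<in>I. \<forall>j<s i. a i j = 0)"
  then obtain i0 j0 where ij0: "i0 \<in> I" "j0 < s i0" "a i0 j0 \<noteq> 0" by auto
  let ?D = "shift_hom g" and ?q = "CARD('a)"
  let ?C = "\<lambda>x::'a mpoly. [:x:]"
  interpret c: comm_ring_hom ?C by (rule pCons_0_hom)
  interpret mc: map_poly_comm_ring_hom ?C ..
  interpret md: map_poly_comm_ring_hom ?D ..
  define H where "H i = U i \<inter> ker" for i
  have H: "finite (H i)" "Fq.subspace (H i)" "H i \<subseteq> linear_forms" "H i \<subseteq> ker" if "i \<in> I" for i
    using U[OF that] subspace_ker by (auto simp: H_def Fq.subspace_inter)
  define u where "u i = (SOME x. x \<in> U i \<and> x \<notin> ker)" for i
  have u: "u i \<in> U i" "u i \<notin> ker" if "\<not> U i \<subseteq> ker" for i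
    using someI_ex[of "\<lambda>x. x \<in> U i \<and> x \<notin> ker"] that unfolding u_def by blast+
  \<comment> \<open>The shifted value of F_H(u)^(q-1), the factor in the recursion for F_U. Its
    degree in T is (q-1) |H| > 0, since \<open>u i\<close> becomes u + g(u) T with g(u)
    nonzero.\<close>
  define t where "t i = poly (map_poly ?C (vanishing_poly (H i))) (?D (u i)) ^ (?q - 1)" for i
  have deg_t: "0 < degree (t i)" "t i \<noteq> 0" if i: "i \<in> I" "\<not> U i \<subseteq> ker" for i
  proof -
    have Du: "?D (u i) = [:u i, const_poly (g (u i)):]"
      using u[OF i(2)] U[OF i(1)] by (intro shift_hom_linear_form) auto
    have gu: "g (u i) \<noteq> 0" using u[OF i(2)] by (simp add: ker_def)
    have eq: "poly (map_poly ?C (vanishing_poly (H i))) (?D (u i)) = (\<Prod>x\<in>H i. [:u i - x, const_poly (g (u i)):])"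
      by (simp add: c.map_poly_vanishing_poly poly_prod Du)
    have "degree (\<Prod>x\<in>H i. [:u i - x, const_poly (g (u i)):]) = card (H i)"
      using gu by (subst degree_prod_eq_sum_degree) auto
    moreover have "0 < card (H i)"
      using H[OF i(1)] Fq.subspace_0[of "H i"] by (auto simp: card_gt_0_iff)
    moreover have "(\<Prod>x\<in>H i. [:u i - x, const_poly (g (u i)):]) \<noteq> 0"
      using gu H[OF i(1)] by simp
    ultimately show "0 < degree (t i)" "t i \<noteq> 0"
      using card_UNIV_ge_2[where 'a='a] by (simp_all add: t_def eq degree_power_eq)
  qed
  \<comment> \<open>After the shift each term involves two consecutive powers of F_H:
    \<open>b\<close> is the coefficient of the lower one, \<open>e\<close> that of the higher one.
    Inside \<open>ker\<close> nothing moves and only \<open>b\<close> occurs.\<close>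
  define b where "b i j = (if U i \<subseteq> ker then ?D (a i j) else - ?D (a i j) * t i ^ (?q ^ j))" for i j
  define e where "e i j = (if U i \<subseteq> ker then 0 else ?D (a i j))" for i j
  have DF: "Polynomial.smult (?D (a i j)) (map_poly ?D (vanishing_poly (U i)) ^ (?q ^ j)) =
      Polynomial.smult (b i j) (map_poly ?C (vanishing_poly (H i) ^ (?q ^ j))) +
      Polynomial.smult (e i j) (map_poly ?C (vanishing_poly (H i) ^ (?q ^ Suc j)))" if i: "i \<in> I" for i j
  proof (cases "U i \<subseteq> ker")
    case True
    then have "H i = U i" by (auto simp: H_def)
    then show ?thesis
      using True U[OF i] by (simp add: map_poly_shift_hom_vanishing_poly b_def e_def mc.hom_power)
  next
    case False
    have Ui: "U i = adjoin (H i) (u i)"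
      unfolding H_def using U[OF i] u[OF False] by (intro adjoin_ker)
    have uH: "u i \<notin> H i" using u[OF False] by (simp add: H_def)
    have "vanishing_poly (U i) = vanishing_poly (H i) ^ ?q -
        Polynomial.smult (poly (vanishing_poly (H i)) (u i) ^ (?q - 1)) (vanishing_poly (H i))"
      unfolding Ui using H[OF i] uH by (intro vanishing_poly_adjoin q_linear_vanishing_poly)
    then have "map_poly ?D (vanishing_poly (U i)) = map_poly ?C (vanishing_poly (H i)) ^ ?q -
        Polynomial.smult (t i) (map_poly ?C (vanishing_poly (H i)))"
      using H[OF i]
      by (simp add: md.hom_minus md.hom_power shift.map_poly_hom_smult map_poly_shift_hom_vanishing_poly
          shift.hom_power t_def shift.poly_map_poly[symmetric])
    then have "map_poly ?D (vanishing_poly (U i)) ^ (?q ^ j) = map_poly ?C (vanishing_poly (H i)) ^ (?q ^ Suc j) -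
        Polynomial.smult (t i ^ (?q ^ j)) (map_poly ?C (vanishing_poly (H i)) ^ (?q ^ j))"
      by (simp add: mpoly_poly_poly_power_card_diff power_mult smult_power)
    then show ?thesis
      using False by (simp add: b_def e_def smult_diff_right mc.hom_power)
  qed
  have "map_poly ?D (\<Sum>i\<in>I. \<Sum>j<s i. Polynomial.smult (a i j) (vanishing_poly (U i) ^ (?q ^ j))) = 0"
    by (simp only: rel md.hom_zero)
  then have rel': "(\<Sum>i\<in>I. \<Sum>j<s i. Polynomial.smult (b i j) (map_poly ?C (vanishing_poly (H i) ^ (?q ^ j))) +
      Polynomial.smult (e i j) (map_poly ?C (vanishing_poly (H i) ^ (?q ^ Suc j)))) = 0"
    by (simp add: md.hom_sum shift.map_poly_hom_smult md.hom_power DF del: power_Suc)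
  define S where "S = {(i, j). i \<in> I \<and> j < s i \<and> a i j \<noteq> 0}"
  have "S \<subseteq> Sigma I (\<lambda>i. {..<s i})" by (auto simp: S_def)
  then have finS: "finite S" using \<open>finite I\<close> finite_subset by blast
  have S0: "(i0, j0) \<in> S" using ij0 by (simp add: S_def)
  define N where "N = Max ((\<lambda>(i, j). degree (b i j)) ` S)"
  have deg_b: "degree (b i j) \<le> N" if "i \<in> I" "j < s i" "a i j \<noteq> 0" for i j
    unfolding N_def using finS that by (intro Max_ge) (auto simp: S_def intro!: image_eqI[of _ _ "(i, j)"])
  have "N \<in> (\<lambda>(i, j). degree (b i j)) ` S"
    unfolding N_def using finS S0 by (intro Max_in) auto
  then obtain i1 j1 where ij1: "i1 \<in> I" "j1 < s i1" "a i1 j1 \<noteq> 0" "degree (b i1 j1) = N"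
    by (auto simp: S_def)
  \<comment> \<open>A nonzero \<open>e i j\<close> has smaller degree in T than its partner
    \<open>b i j\<close>, which carries the extra factor \<open>t i ^ (?q ^ j)\<close>. So at T^N
    only the \<open>b\<close> terms remain.\<close>
  have e0: "coeff (e i j) N = 0" if ij: "i \<in> I" "j < s i" for i j
  proof (cases "a i j = 0 \<or> U i \<subseteq> ker")
    case False
    then have "degree (b i j) = degree (?D (a i j)) + ?q ^ j * degree (t i)"
      using deg_t[OF ij(1)] by (simp add: b_def degree_mult_eq degree_power_eq)
    moreover have "0 < ?q ^ j * degree (t i)" using deg_t[OF ij(1)] False by simp
    moreover have "degree (b i j) \<le> N" "degree (e i j) = degree (?D (a i j))"
      using deg_b[OF ij] False by (simp_all add: e_def)
    ultimately have "degree (e i j) < N" by linarith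
    then show ?thesis by (rule coeff_eq_0)
  qed (auto simp: e_def)
  have "(\<Sum>i\<in>I. \<Sum>j<s i. Polynomial.smult (coeff (b i j) N) (vanishing_poly (H i) ^ (?q ^ j))) = 0"
  proof (rule poly_eqI)
    fix x
    have "coeff (\<Sum>i\<in>I. \<Sum>j<s i. Polynomial.smult (coeff (b i j) N) (vanishing_poly (H i) ^ (?q ^ j))) x =
      (\<Sum>i\<in>I. \<Sum>j<s i. coeff (b i j) N * coeff (vanishing_poly (H i) ^ (?q ^ j)) x +
         coeff (e i j) N * coeff (vanishing_poly (H i) ^ (?q ^ Suc j)) x)"
      by (simp add: coeff_sum e0)
    also have "\<dots> = coeff (coeff (\<Sum>i\<in>I. \<Sum>j<s i. Polynomial.smult (b i j) (map_poly ?C (vanishing_poly (H i) ^ (?q ^ j))) +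
      Polynomial.smult (e i j) (map_poly ?C (vanishing_poly (H i) ^ (?q ^ Suc j)))) x) N"
      by (simp add: coeff_sum coeff_map_poly mult.commute del: power_Suc)
    finally show "coeff (\<Sum>i\<in>I. \<Sum>j<s i. Polynomial.smult (coeff (b i j) N) (vanishing_poly (H i) ^ (?q ^ j))) x = coeff 0 x"
      unfolding rel' by simp
  qed
  \<comment> \<open>The coefficient of T^N is a relation among the powers of F_H, yet
    \<open>N\<close> is the degree of the nonzero \<open>b i1 j1\<close>.\<close>
  then have "coeff (b i1 j1) N = 0"
    using indep[folded H_def, unfolded family_indep_def, rule_format, of "\<lambda>i j. coeff (b i j) N" i1 j1] ij1
    by simp
  then have "b i1 j1 = 0" using ij1 by (metis leading_coeff_0_iff)
  then show False
    using ij1 deg_t[of i1] by (auto simp: b_def split: if_splits)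
qed

end

section \<open>Dimensions and combinations of Frobenius powers\<close>

text \<open>Dimension measured by cardinality: on finite subspaces this is the exact logarithm to
  base q, so dimension arguments become counting.\<close>

definition qdim :: "'a::{finite,field} mpoly set \<Rightarrow> nat" where
  "qdim S = (LEAST d. card S \<le> CARD('a) ^ d)"

lemma power_card_le_iff: "CARD('a::{finite,field}) ^ m \<le> CARD('a) ^ n \<longleftrightarrow> m \<le> n"
  using card_UNIV_ge_2[where 'a='a] by simp

lemma qdim_eqI: "card (S :: 'a::{finite,field} mpoly set) = CARD('a) ^ d \<Longrightarrow> qdim S = d"
  unfolding qdim_def by (rule Least_equality) (simp_all add: power_card_le_iff)

lemma card_eq_power_qdim:
  assumes "finite S" "Fq.subspace (S :: 'a::{finite,field} mpoly set)"
  shows "card S = CARD('a) ^ qdim S"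
  using card_subspace[OF assms] qdim_eqI by metis

lemma qdim_mono:
  assumes "finite T" "Fq.subspace S" "Fq.subspace T" "S \<subseteq> T"
  shows "qdim S \<le> qdim (T :: 'a::{finite,field} mpoly set)"
proof -
  have "card S \<le> card T" using assms by (intro card_mono)
  then show ?thesis
    using assms card_eq_power_qdim[of S] card_eq_power_qdim[of T] finite_subset[of S T]
    by (simp add: power_card_le_iff)
qed

lemma qdim_adjoin:
  assumes "finite H" "Fq.subspace H" "u \<notin> H"
  shows "qdim (adjoin H u) = Suc (qdim (H :: 'a::{finite,field} mpoly set))"
  using assms by (intro qdim_eqI) (simp add: card_adjoin card_eq_power_qdim)

lemma (in Fq_functional) qdim_ker:
  assumes "finite U" "Fq.subspace U" "\<not> U \<subseteq> ker"
  shows "qdim U = Suc (qdim (U \<inter> ker))"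
proof -
  obtain u where u: "u \<in> U" "u \<notin> ker" using assms by auto
  have "U = adjoin (U \<inter> ker) u" using assms u by (intro adjoin_ker)
  moreover have "qdim (adjoin (U \<inter> ker) u) = Suc (qdim (U \<inter> ker))"
    using assms u subspace_ker by (intro qdim_adjoin) (auto intro: Fq.subspace_inter)
  ultimately show ?thesis by simp
qed

lemma exists_separating_functional:
  fixes U :: "'a::{finite,field} mpoly set"
  assumes "Fq.subspace U" "x \<notin> U"
  obtains g where "Fq_functional g" "\<And>y. y \<in> U \<Longrightarrow> g y = 0" "g x = 1"
proof -
  interpret vs: vector_space "(*) :: 'a \<Rightarrow> 'a \<Rightarrow> 'a"
    by unfold_locales (simp_all add: algebra_simps)
  interpret p: vector_space_pair "\<lambda>(c::'a) x. const_poly c * (x :: 'a mpoly)" "(*) :: 'a \<Rightarrow> 'a \<Rightarrow> 'a"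
    by unfold_locales
  obtain B where B: "B \<subseteq> U" "Fq.independent B" "U \<subseteq> Fq.span B"
    using Fq.maximal_independent_subset by blast
  have "Fq.span B = U" using B assms Fq.span_minimal by blast
  then have ind: "Fq.independent (insert x B)"
    using B assms by (intro Fq.independent_insertI) auto
  define g where "g = p.construct (insert x B) (\<lambda>y. if y = x then 1 else 0)"
  have lin: "Vector_Spaces.linear (\<lambda>(c::'a) x. const_poly c * (x :: 'a mpoly)) (*) g"
    unfolding g_def by (rule p.linear_construct[OF ind])
  interpret l: Vector_Spaces.linear "\<lambda>(c::'a) x. const_poly c * (x :: 'a mpoly)" "(*)" g by (rule lin)
  have "g y = 0" if "y \<in> B" for y
    using that assms B unfolding g_def by (subst p.construct_basis[OF ind]) auto
  then have "g y = 0" if "y \<in> U" for y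
    using that l.eq_0_on_span[of B y] \<open>Fq.span B = U\<close> by blast
  moreover have "g x = 1" unfolding g_def by (subst p.construct_basis[OF ind]) auto
  moreover have "Fq_functional g" by unfold_locales (simp_all add: l.add l.scale)
  ultimately show ?thesis using that by blast
qed

text \<open>The compositions P(F_U) with P linearized of degree below q^N.\<close>

definition qspan :: "'a::{finite,field} mpoly set \<Rightarrow> nat \<Rightarrow> 'a mpoly poly set" where
  "qspan U N = range (\<lambda>c. \<Sum>j<N. Polynomial.smult (c j) (vanishing_poly U ^ (CARD('a) ^ j)))"

lemma qspan_0: "0 \<in> qspan U N"
  unfolding qspan_def by (rule image_eqI[of _ _ "\<lambda>_. 0"]) auto

lemma qspan_add:
  assumes "p \<in> qspan U N" "r \<in> qspan U N"
  shows "p + r \<in> qspan U N"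
proof -
  obtain c d where "p = (\<Sum>j<N. Polynomial.smult (c j) (vanishing_poly U ^ (CARD('a) ^ j)))"
    "r = (\<Sum>j<N. Polynomial.smult (d j) (vanishing_poly (U :: 'a::{finite,field} mpoly set) ^ (CARD('a) ^ j)))"
    using assms by (auto simp: qspan_def)
  then show ?thesis
    unfolding qspan_def by (intro image_eqI[of _ _ "\<lambda>j. c j + d j"]) (simp_all add: smult_add_left sum.distrib)
qed

lemma qspan_smult:
  assumes "p \<in> qspan U N"
  shows "Polynomial.smult a p \<in> qspan U N"
proof -
  obtain c where "p = (\<Sum>j<N. Polynomial.smult (c j) (vanishing_poly (U :: 'a::{finite,field} mpoly set) ^ (CARD('a) ^ j)))"
    using assms by (auto simp: qspan_def)
  then show ?thesis
    unfolding qspan_def by (intro image_eqI[of _ _ "\<lambda>j. a * c j"]) (simp_all add: smult_sum2)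
qed

lemma qspan_sum: "(\<And>i. i \<in> I \<Longrightarrow> p i \<in> qspan U N) \<Longrightarrow> (\<Sum>i\<in>I. p i) \<in> qspan U N"
  by (induction I rule: infinite_finite_induct) (auto intro: qspan_0 qspan_add)

lemma qspan_base: "j < N \<Longrightarrow> vanishing_poly (U :: 'a::{finite,field} mpoly set) ^ (CARD('a) ^ j) \<in> qspan U N"
  unfolding qspan_def
  by (rule image_eqI[of _ _ "\<lambda>i. if i = j then 1 else 0"])
    (auto simp: if_distrib[of "\<lambda>c. Polynomial.smult c _"] cong: if_cong)

lemma qspan_mono:
  assumes "p \<in> qspan U N" "N \<le> M"
  shows "p \<in> qspan U M"
proof -
  obtain c where "p = (\<Sum>j<N. Polynomial.smult (c j) (vanishing_poly U ^ (CARD('a) ^ j)))"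
    using assms by (auto simp: qspan_def)
  with assms(2) show ?thesis
    by (auto intro!: qspan_sum qspan_smult qspan_base)
qed

lemma qspan_power:
  assumes "p \<in> qspan (U :: 'a::{finite,field} mpoly set) N"
  shows "p ^ (CARD('a) ^ m) \<in> qspan U (N + m)"
proof -
  obtain c where p: "p = (\<Sum>j<N. Polynomial.smult (c j) (vanishing_poly U ^ (CARD('a) ^ j)))"
    using assms by (auto simp: qspan_def)
  have "p ^ (CARD('a) ^ m) =
      (\<Sum>j<N. Polynomial.smult (c j ^ (CARD('a) ^ m)) (vanishing_poly U ^ (CARD('a) ^ (j + m))))"
    by (simp add: p sum_mpoly_poly_power_card smult_power power_add power_mult)
  also have "\<dots> \<in> qspan U (N + m)"
    by (intro qspan_sum qspan_smult qspan_base) auto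
  finally show ?thesis .
qed

text \<open>By the recursion for F, each vector adjoined to \<open>U0\<close> costs one further
  Frobenius power.\<close>

lemma vanishing_poly_mem_qspan:
  fixes U :: "'a::{finite,field} mpoly set"
  assumes "finite U" "Fq.subspace U" "Fq.subspace U0" "U0 \<subseteq> U"
  shows "vanishing_poly U \<in> qspan U0 (Suc (qdim U - qdim U0))"
  using assms
proof (induction U rule: subspace_interval_induct)
  case base
  then show ?case using qspan_base[of 0 1 U0] by simp
next
  case (adjoin H u)
  let ?d = "Suc (qdim H - qdim U0)"
  have H: "finite H" using adjoin assms finite_subset by blast
  have "qdim U0 \<le> qdim H" using adjoin assms H by (intro qdim_mono)
  then have d: "Suc (qdim (adjoin H u) - qdim U0) = ?d + 1"
    using adjoin H by (simp add: qdim_adjoin)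
  have "vanishing_poly H ^ (CARD('a) ^ 1) \<in> qspan U0 (?d + 1)"
    by (intro qspan_power adjoin)
  moreover have "vanishing_poly H \<in> qspan U0 (?d + 1)"
    by (rule qspan_mono[OF adjoin(6)]) simp
  ultimately have "vanishing_poly H ^ (CARD('a) ^ 1) +
      Polynomial.smult (- (poly (vanishing_poly H) u ^ (CARD('a) - 1))) (vanishing_poly H) \<in> qspan U0 (?d + 1)"
    by (intro qspan_add qspan_smult)
  then show ?case
    unfolding d using adjoin H q_linear_vanishing_poly[of H] by (simp add: vanishing_poly_adjoin)
qed

section \<open>Reductions for joint independence: dropping, merging, comparing top
  coefficients\<close>

lemma family_indepD:
  fixes U :: "'i \<Rightarrow> 'a::{finite,field} mpoly set"
  assumes "family_indep I U s"
    and "(\<Sum>i\<in>I. \<Sum>j<s i. Polynomial.smult (a i j) (vanishing_poly (U i) ^ (CARD('a) ^ j))) = 0"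
  shows "\<forall>i\<in>I. \<forall>j<s i. a i j = 0"
  using assms(1)[unfolded family_indep_def, rule_format, of a, OF assms(2)] by blast

lemma family_indep_remove:
  fixes U :: "'i \<Rightarrow> 'a::{finite,field} mpoly set"
  assumes "finite I" "s i = 0" and indep: "family_indep (I - {i}) U s"
  shows "family_indep I U s"
  unfolding family_indep_def
proof (intro allI impI ballI)
  fix a i' j
  let ?f = "\<lambda>i. \<Sum>j<s i. Polynomial.smult (a i j) (vanishing_poly (U i) ^ (CARD('a) ^ j))"
  assume rel: "(\<Sum>i\<in>I. ?f i) = 0" and i': "i' \<in> I" "j < s i'"
  have "(\<Sum>i\<in>I. ?f i) = (\<Sum>i\<in>I-{i}. ?f i)"
    using assms(1,2) by (intro sum.mono_neutral_right) auto
  then have "(\<Sum>i\<in>I-{i}. ?f i) = 0" using rel by simp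
  from family_indepD[OF indep this] i' assms(2) show "a i' j = 0" by (cases "i' = i") auto
qed

text \<open>The part of a relation over \<open>\<Omega>\<close> is rewritten through powers of the
  single polynomial of \<open>U0\<close>. Independence of the merged system kills that part as a
  whole, and independence inside \<open>\<Omega>\<close> then kills its coefficients. The index
  \<open>i0\<close> merely serves as the name of the merged pair.\<close>

lemma family_indep_merge:
  fixes U :: "'i \<Rightarrow> 'a::{finite,field} mpoly set"
  assumes "finite I" "\<Omega> \<subseteq> I" "i0 \<in> \<Omega>"
    and mem: "\<And>i j. i \<in> \<Omega> \<Longrightarrow> j < s i \<Longrightarrow> vanishing_poly (U i) ^ (CARD('a) ^ j) \<in> qspan U0 s0"
    and sub: "family_indep \<Omega> U s"
    and merged: "family_indep (insert i0 (I - \<Omega>)) (U(i0 := U0)) (s(i0 := s0))"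
  shows "family_indep I U s"
  unfolding family_indep_def
proof (intro allI impI)
  fix a
  let ?f = "\<lambda>i. \<Sum>j<s i. Polynomial.smult (a i j) (vanishing_poly (U i) ^ (CARD('a) ^ j))"
  assume rel: "(\<Sum>i\<in>I. ?f i) = 0"
  have split: "(\<Sum>i\<in>I. ?f i) = (\<Sum>i\<in>\<Omega>. ?f i) + (\<Sum>i\<in>I - \<Omega>. ?f i)"
    using sum.subset_diff[OF assms(2,1), of ?f] by (simp add: add.commute)
  have "(\<Sum>i\<in>\<Omega>. ?f i) \<in> qspan U0 s0"
    by (intro qspan_sum qspan_smult mem) auto
  then obtain c where c: "(\<Sum>i\<in>\<Omega>. ?f i) = (\<Sum>j<s0. Polynomial.smult (c j) (vanishing_poly U0 ^ (CARD('a) ^ j)))"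
    by (auto simp: qspan_def)
  define b where "b i j = (if i = i0 then c j else a i j)" for i j
  let ?h = "\<lambda>i. \<Sum>j<(s(i0 := s0)) i. Polynomial.smult (b i j) (vanishing_poly ((U(i0 := U0)) i) ^ (CARD('a) ^ j))"
  have "(\<Sum>i\<in>I - \<Omega>. ?h i) = (\<Sum>i\<in>I - \<Omega>. ?f i)"
    using assms(3) by (intro sum.cong) (auto simp: b_def)
  moreover have "?h i0 = (\<Sum>i\<in>\<Omega>. ?f i)" unfolding c by (simp add: b_def)
  ultimately have "(\<Sum>i\<in>insert i0 (I - \<Omega>). ?h i) = 0"
    using rel split \<open>finite I\<close> \<open>i0 \<in> \<Omega>\<close> by (simp del: fun_upd_apply)
  then have b0: "\<forall>i\<in>insert i0 (I - \<Omega>). \<forall>j<(s(i0 := s0)) i. b i j = 0"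
    by (rule family_indepD[OF merged])
  then have "c j = 0" if "j < s0" for j using that by (auto simp: b_def)
  then have "(\<Sum>i\<in>\<Omega>. ?f i) = 0" unfolding c by simp
  then have "\<forall>i\<in>\<Omega>. \<forall>j<s i. a i j = 0" by (rule family_indepD[OF sub])
  moreover have "\<forall>i\<in>I - \<Omega>. \<forall>j<s i. a i j = 0"
  proof (intro ballI allI impI)
    fix i j assume "i \<in> I - \<Omega>" "j < s i"
    with b0 assms(3) show "a i j = 0" by (auto simp: b_def split: if_splits)
  qed
  ultimately show "\<forall>i\<in>I. \<forall>j<s i. a i j = 0" by blast
qed

text \<open>The last member of family \<open>i0\<close> is the only one of degree q^(k-1) and it is
  monic, so its coefficient in any relation is zero.\<close>

lemma family_indep_top:
  fixes U :: "'i \<Rightarrow> 'a::{finite,field} mpoly set"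
  assumes "finite I" "i0 \<in> I"
    and U: "\<And>i. i \<in> I \<Longrightarrow> finite (U i)" "\<And>i. i \<in> I \<Longrightarrow> Fq.subspace (U i)"
    and i0: "s i0 = Suc m" "Suc m + qdim (U i0) = k"
    and less: "\<And>i. i \<in> I \<Longrightarrow> i \<noteq> i0 \<Longrightarrow> s i + qdim (U i) < k"
    and indep: "family_indep I U (s(i0 := m))"
  shows "family_indep I U s"
  unfolding family_indep_def
proof (intro allI impI)
  fix a
  let ?t = "\<lambda>i j. Polynomial.smult (a i j) (vanishing_poly (U i) ^ (CARD('a) ^ j))"
  let ?f = "\<lambda>i. \<Sum>j<s i. ?t i j" and ?g = "\<lambda>i. \<Sum>j<(s(i0 := m)) i. ?t i j"
  assume rel: "(\<Sum>i\<in>I. ?f i) = 0"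
  have f: "(\<Sum>i\<in>I. ?f i) = ?f i0 + (\<Sum>i\<in>I-{i0}. ?f i)"
    by (rule sum.remove[OF assms(1,2)])
  have g: "(\<Sum>i\<in>I. ?g i) = ?g i0 + (\<Sum>i\<in>I-{i0}. ?g i)"
    by (rule sum.remove[OF assms(1,2)])
  have fg: "(\<Sum>i\<in>I-{i0}. ?f i) = (\<Sum>i\<in>I-{i0}. ?g i)" by (intro sum.cong) auto
  have "?f i0 = ?g i0 + ?t i0 m" by (simp add: i0)
  then have split: "(\<Sum>i\<in>I. ?g i) + ?t i0 m = 0"
    using rel unfolding f g fg by (simp only: add_ac)
  have deg: "degree (vanishing_poly (U i) ^ (CARD('a) ^ j)) = CARD('a) ^ (qdim (U i) + j)" if "i \<in> I" for i j
    using U[OF that] by (simp add: degree_power_eq degree_vanishing_poly card_eq_power_qdim power_add mult.commute)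
  have low: "coeff (vanishing_poly (U i) ^ (CARD('a) ^ j)) (CARD('a) ^ (k - 1)) = 0"
    if "i \<in> I" "j < (s(i0 := m)) i" for i j
  proof (rule coeff_eq_0)
    have "qdim (U i) + j < k - 1"
      using that i0 less[of i] by (auto split: if_splits)
    then show "degree (vanishing_poly (U i) ^ (CARD('a) ^ j)) < CARD('a) ^ (k - 1)"
      unfolding deg[OF that(1)] using card_UNIV_ge_2[where 'a='a] by (intro power_strict_increasing) auto
  qed
  let ?P = "vanishing_poly (U i0) ^ (CARD('a) ^ m)" and ?K = "CARD('a) ^ (k - 1)"
  have k1: "k - 1 = qdim (U i0) + m" using i0(2) by linarith
  have "coeff ?P (degree ?P) = 1"
    unfolding lead_coeff_power monic_vanishing_poly by (rule power_one)
  then have 1: "coeff ?P ?K = 1"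
    unfolding deg[OF assms(2)] k1 .
  have 2: "coeff (\<Sum>i\<in>I. ?g i) ?K = 0"
  proof -
    have "coeff (?g i) ?K = 0" if "i \<in> I" for i
      unfolding coeff_sum using low[OF that] by (intro sum.neutral) auto
    then show ?thesis unfolding coeff_sum[of ?g] by (intro sum.neutral) auto
  qed
  have "coeff (\<Sum>i\<in>I. ?g i) ?K + coeff (?t i0 m) ?K = 0"
    by (simp only: split coeff_0 flip: coeff_add)
  then have top: "a i0 m = 0"
    unfolding 2 coeff_smult 1 by simp
  with split have "(\<Sum>i\<in>I. ?g i) = 0" by simp
  then have "\<forall>i\<in>I. \<forall>j<(s(i0 := m)) i. a i j = 0"
    by (rule family_indepD[OF indep])
  then have *: "a i j = 0" if "i \<in> I" "j < (s(i0 := m)) i" for i j using that by blast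
  show "\<forall>i\<in>I. \<forall>j<s i. a i j = 0"
  proof (intro ballI allI impI)
    fix i j assume "i \<in> I" "j < s i"
    with *[of i j] top i0(1) show "a i j = 0"
      by (cases "i = i0"; cases "j = m") (auto simp: less_Suc_eq)
  qed
qed

section \<open>Independence of admissible families\<close>

text \<open>Letting \<open>t\<close> run over the common lower bounds of \<open>r\<close> on
  \<open>\<Omega>\<close> states the inequality for the minimum and lets every proof choose a
  convenient \<open>t\<close>.\<close>

definition admissible :: "nat \<Rightarrow> 'i set \<Rightarrow> ('i \<Rightarrow> 'a::{finite,field} mpoly set) \<Rightarrow> ('i \<Rightarrow> nat) \<Rightarrow> ('i \<Rightarrow> nat) \<Rightarrow> bool" where
  "admissible k I U r s \<longleftrightarrow> finite I \<and>
    (\<forall>i\<in>I. finite (U i) \<and> Fq.subspace (U i) \<and> U i \<subseteq> linear_forms \<and> s i + qdim (U i) + r i = k) \<and>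
    (\<forall>\<Omega> t. \<Omega> \<subseteq> I \<longrightarrow> \<Omega> \<noteq> {} \<longrightarrow> (\<forall>i\<in>\<Omega>. t \<le> r i) \<longrightarrow> sum s \<Omega> + qdim (\<Inter>i\<in>\<Omega>. U i) + t \<le> k)"

lemma admissible_subset: "admissible k I U r s \<Longrightarrow> J \<subseteq> I \<Longrightarrow> admissible k J U r s"
  unfolding admissible_def by (meson finite_subset subset_iff subset_trans)

lemma admissibleD:
  assumes "admissible k I U r s"
  shows "finite I"
    and "i \<in> I \<Longrightarrow> finite (U i)" "i \<in> I \<Longrightarrow> Fq.subspace (U i)" "i \<in> I \<Longrightarrow> U i \<subseteq> linear_forms"
    and "i \<in> I \<Longrightarrow> s i + qdim (U i) + r i = k"
    and "\<Omega> \<subseteq> I \<Longrightarrow> \<Omega> \<noteq> {} \<Longrightarrow> (\<And>i. i \<in> \<Omega> \<Longrightarrow> t \<le> r i) \<Longrightarrow> sum s \<Omega> + qdim (\<Inter>i\<in>\<Omega>. U i) + t \<le> k"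
  using assms unfolding admissible_def by auto

lemma admissible_Inter:
  assumes "admissible k I U r s" "\<Omega> \<subseteq> I" "\<Omega> \<noteq> {}"
  shows "finite (\<Inter>i\<in>\<Omega>. U i)" "Fq.subspace (\<Inter>i\<in>\<Omega>. U i)" "(\<Inter>i\<in>\<Omega>. U i) \<subseteq> linear_forms"
proof -
  obtain i where i: "i \<in> \<Omega>" using assms by auto
  then show "finite (\<Inter>i\<in>\<Omega>. U i)" "(\<Inter>i\<in>\<Omega>. U i) \<subseteq> linear_forms"
    using admissibleD(2,4)[OF assms(1), of i] assms(2) by (auto intro: finite_subset)
  show "Fq.subspace (\<Inter>i\<in>\<Omega>. U i)"
    using admissibleD(3)[OF assms(1)] assms(2) by (intro Fq.subspace_Int) auto
qed

text \<open>For nonempty \<open>\<Omega>\<close> in an admissible system the equality forces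
  \<open>t\<close> to be the minimum of \<open>r\<close> on \<open>\<Omega>\<close>, as t + 1 would
  violate the bound.\<close>

definition tight :: "nat \<Rightarrow> ('i \<Rightarrow> 'a::{finite,field} mpoly set) \<Rightarrow> ('i \<Rightarrow> nat) \<Rightarrow> ('i \<Rightarrow> nat) \<Rightarrow> 'i set \<Rightarrow> nat \<Rightarrow> bool" where
  "tight k U r s \<Omega> t \<longleftrightarrow> (\<forall>i\<in>\<Omega>. t \<le> r i) \<and> sum s \<Omega> + qdim (\<Inter>i\<in>\<Omega>. U i) + t = k"

text \<open>A constraint that uses the merged pair is the old constraint with that index replaced by
  all of \<open>\<Omega>\<close>: sums and intersections agree, and t' is at most \<open>t\<close>,
  hence a lower bound on \<open>\<Omega>\<close> too.\<close>

lemma admissible_merge: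
  assumes adm: "admissible k I U r s" and "\<Omega> \<subseteq> I" "i0 \<in> \<Omega>" and tight: "tight k U r s \<Omega> t"
  shows "admissible k (insert i0 (I - \<Omega>)) (U(i0 := \<Inter>i\<in>\<Omega>. U i)) (r(i0 := t)) (s(i0 := sum s \<Omega>))"
    (is "admissible k ?I ?U ?r ?s")
  unfolding admissible_def
proof (intro conjI ballI allI impI)
  have ne: "\<Omega> \<noteq> {}" using assms by auto
  note D = admissibleD[OF adm] and Int = admissible_Inter[OF adm assms(2) ne]
  show "finite ?I" using D(1) by simp
  fix i assume i: "i \<in> ?I"
  show "finite (?U i)" "Fq.subspace (?U i)" "?U i \<subseteq> linear_forms" "?s i + qdim (?U i) + ?r i = k"
    using i D(2-5)[of i] Int tight by (auto simp: tight_def)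
next
  note D = admissibleD[OF adm]
  fix \<Omega>' t' assume \<Omega>': "\<Omega>' \<subseteq> ?I" "\<Omega>' \<noteq> {}" "\<forall>i\<in>\<Omega>'. t' \<le> ?r i"
  have fin: "finite \<Omega>'" using \<Omega>'(1) D(1) by (meson finite.insertI finite_Diff finite_subset)
  have fin\<Omega>: "finite \<Omega>" using assms(2) D(1) finite_subset by blast
  show "sum ?s \<Omega>' + qdim (\<Inter>i\<in>\<Omega>'. ?U i) + t' \<le> k"
  proof (cases "i0 \<in> \<Omega>'")
    case False
    then have "sum ?s \<Omega>' = sum s \<Omega>'" "(\<Inter>i\<in>\<Omega>'. ?U i) = (\<Inter>i\<in>\<Omega>'. U i)"
      by (auto intro!: sum.cong)
    moreover have "\<Omega>' \<subseteq> I" using \<Omega>'(1) False by auto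
    moreover have "t' \<le> r i" if "i \<in> \<Omega>'" for i using \<Omega>'(3) that False by (metis fun_upd_other)
    ultimately show ?thesis using D(6)[OF _ \<Omega>'(2)] by simp
  next
    case True
    define \<Omega>1 where "\<Omega>1 = \<Omega>' - {i0}"
    have \<Omega>1: "\<Omega>' = insert i0 \<Omega>1" "i0 \<notin> \<Omega>1" "\<Omega>1 \<subseteq> I - \<Omega>" "finite \<Omega>1"
      using True \<Omega>'(1) fin by (auto simp: \<Omega>1_def)
    have "sum ?s \<Omega>1 = sum s \<Omega>1" using \<Omega>1 by (intro sum.cong) auto
    then have 1: "sum ?s \<Omega>' = sum s (\<Omega> \<union> \<Omega>1)"
      using \<Omega>1 fin\<Omega> by (subst sum.union_disjoint) auto
    have "(\<Inter>i\<in>\<Omega>1. ?U i) = (\<Inter>i\<in>\<Omega>1. U i)" using \<Omega>1 by auto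
    then have 2: "(\<Inter>i\<in>\<Omega>'. ?U i) = (\<Inter>i\<in>\<Omega> \<union> \<Omega>1. U i)"
      unfolding \<Omega>1(1) INT_insert Inter_Un_distrib image_Un by simp
    have "t' \<le> t" using \<Omega>'(3) True by auto
    then have 3: "t' \<le> r i" if "i \<in> \<Omega> \<union> \<Omega>1" for i
      using that \<Omega>'(3) \<Omega>1(1,2) tight unfolding tight_def by (metis Un_iff fun_upd_other insertCI le_trans)
    show ?thesis unfolding 1 2
      using \<Omega>1(3) assms(2,3) 3 by (intro D(6)) auto
  qed
qed

text \<open>If all r_i on \<open>\<Omega>\<close> are positive, the old inequality applies with t +
  1. Otherwise \<open>i0\<close> lies in \<open>\<Omega>\<close> with r = 0, so t = 0 and the
  shortened family \<open>i0\<close> supplies the missing unit.\<close>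

lemma admissible_decrease:
  assumes adm: "admissible k I U r s" and "i0 \<in> I" "0 < s i0"
    and r: "\<And>i. i \<in> I \<Longrightarrow> i \<noteq> i0 \<Longrightarrow> 0 < r i"
  shows "admissible (k - 1) I U (\<lambda>i. r i - 1) (if r i0 = 0 then s(i0 := s i0 - 1) else s)"
    (is "admissible _ _ _ ?r ?s")
  unfolding admissible_def
proof (intro conjI ballI allI impI)
  note D = admissibleD[OF adm]
  show "finite I" using D(1) .
  fix i assume i: "i \<in> I"
  show "finite (U i)" "Fq.subspace (U i)" "U i \<subseteq> linear_forms"
    using D(2-4)[OF i] .
  show "?s i + qdim (U i) + ?r i = k - 1"
    using D(5)[OF i] r[OF i] assms(2,3) by (cases "i = i0") auto
next
  note D = admissibleD[OF adm]
  fix \<Omega> t assume \<Omega>: "\<Omega> \<subseteq> I" "\<Omega> \<noteq> {}" "\<forall>i\<in>\<Omega>. t \<le> ?r i"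
  have fin: "finite \<Omega>" using \<Omega>(1) D(1) finite_subset by blast
  show "sum ?s \<Omega> + qdim (\<Inter>i\<in>\<Omega>. U i) + t \<le> k - 1"
  proof (cases "i0 \<in> \<Omega> \<and> r i0 = 0")
    case True
    then have "sum ?s \<Omega> + 1 = sum s \<Omega>"
      using fin assms(3) by (simp add: sum.remove[of \<Omega> i0])
    moreover have "sum s \<Omega> + qdim (\<Inter>i\<in>\<Omega>. U i) + 0 \<le> k" using \<Omega> by (intro D(6)) auto
    moreover have "t = 0" using True \<Omega>(3) by auto
    ultimately show ?thesis by simp
  next
    case False
    then have "sum ?s \<Omega> = sum s \<Omega>" by (auto intro!: sum.cong)
    moreover have rpos: "0 < r i" if "i \<in> \<Omega>" for i
      using that False r[of i] \<Omega>(1) by (cases "i = i0") auto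
    moreover have "sum s \<Omega> + qdim (\<Inter>i\<in>\<Omega>. U i) + Suc t \<le> k"
    proof (rule D(6)[OF \<Omega>(1,2)])
      fix i assume "i \<in> \<Omega>"
      with \<Omega>(3) rpos[of i] show "Suc t \<le> r i" by fastforce
    qed
    ultimately show ?thesis by simp
  qed
qed

text \<open>If the intersection over \<open>\<Omega>\<close> is not inside \<open>ker\<close>, its
  dimension drops by one and pays for t. The critical case is an intersection inside
  \<open>ker\<close> with t exceeding some old r_i. Then \<open>\<Omega>\<close> is proper, since
  \<open>i0\<close> keeps r = 0, and has at least two elements, since U_i itself is not inside
  \<open>ker\<close>; \<open>slack\<close> provides the unit.\<close>

lemma (in Fq_functional) admissible_ker:
  assumes adm: "admissible k I U r s"
    and i0: "i0 \<in> I" "r i0 = 0" "U i0 \<subseteq> ker"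
    and slack: "\<And>\<Omega> t. \<Omega> \<subset> I \<Longrightarrow> 2 \<le> card \<Omega> \<Longrightarrow> \<not> tight k U r s \<Omega> t"
  shows "admissible k I (\<lambda>i. U i \<inter> ker) (\<lambda>i. if U i \<subseteq> ker then r i else Suc (r i)) s"
    (is "admissible _ _ ?U ?r _")
  unfolding admissible_def
proof (intro conjI ballI allI impI)
  note D = admissibleD[OF adm]
  show "finite I" using D(1) .
  fix i assume i: "i \<in> I"
  show "finite (?U i)" "Fq.subspace (?U i)" "?U i \<subseteq> linear_forms"
    using D(2-4)[OF i] subspace_ker by (auto intro: Fq.subspace_inter)
  show "s i + qdim (?U i) + ?r i = k"
    using D(5)[OF i] qdim_ker[OF D(2,3)[OF i]] by (cases "U i \<subseteq> ker") (simp_all add: Int_absorb2)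
next
  note D = admissibleD[OF adm]
  fix \<Omega> t assume \<Omega>: "\<Omega> \<subseteq> I" "\<Omega> \<noteq> {}" "\<forall>i\<in>\<Omega>. t \<le> ?r i"
  let ?X = "\<Inter>i\<in>\<Omega>. U i"
  note X = admissible_Inter[OF adm \<Omega>(1,2)]
  have Int: "(\<Inter>i\<in>\<Omega>. ?U i) = ?X \<inter> ker" using \<Omega>(2) by auto
  show "sum s \<Omega> + qdim (\<Inter>i\<in>\<Omega>. ?U i) + t \<le> k"
  proof (cases "?X \<subseteq> ker")
    case False
    have "sum s \<Omega> + qdim ?X + (t - 1) \<le> k"
    proof (rule D(6)[OF \<Omega>(1,2)])
      fix i assume "i \<in> \<Omega>"
      with \<Omega>(3) show "t - 1 \<le> r i" by (fastforce split: if_splits)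
    qed
    then show ?thesis unfolding Int using qdim_ker[OF X(1,2) False] by linarith
  next
    case True
    then have X': "?X \<inter> ker = ?X" by auto
    show ?thesis
    proof (cases "\<forall>i\<in>\<Omega>. t \<le> r i")
      case True
      then show ?thesis unfolding Int X' using \<Omega> by (intro D(6)) auto
    next
      case False
      then have t: "t \<noteq> 0" by auto
      have "\<Omega> \<noteq> I" using \<Omega>(3) i0 t by fastforce
      then have "\<Omega> \<subset> I" using \<Omega>(1) by auto
      obtain i where i: "i \<in> \<Omega>" "\<not> t \<le> r i" using False by auto
      then have "\<not> U i \<subseteq> ker" using \<Omega>(3) by (auto split: if_splits)
      then have "\<Omega> \<noteq> {i}" using \<open>?X \<subseteq> ker\<close> by auto
      then have "{i} \<subset> \<Omega>" using i by auto
      moreover have "finite \<Omega>" using \<Omega>(1) D(1) finite_subset by blast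
      ultimately have "card {i} < card \<Omega>" by (intro psubset_card_mono)
      then have "2 \<le> card \<Omega>" by simp
      then have "\<not> tight k U r s \<Omega> (t - 1)" using slack \<open>\<Omega> \<subset> I\<close> by blast
      moreover have r: "t - 1 \<le> r i" if "i \<in> \<Omega>" for i
        using \<Omega>(3) that by (fastforce split: if_splits)
      moreover have "sum s \<Omega> + qdim ?X + (t - 1) \<le> k"
        by (rule D(6)[OF \<Omega>(1,2) r])
      ultimately have "sum s \<Omega> + qdim ?X + (t - 1) < k" unfolding tight_def by fastforce
      then show ?thesis unfolding Int X' using t by simp
    qed
  qed
qed

text \<open>Comparing s_i + dim U_i + r_i = k with the tight equality and t <= r_i gives dim U_i -
  dim X + s_i <= sum s, where X is the intersection. So every power used by family \<open>i\<close>
  fits.\<close>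

lemma tight_mem_qspan:
  assumes adm: "admissible k I U r s" and "\<Omega> \<subseteq> I" "i \<in> \<Omega>" "j < s i" and tight: "tight k U r s \<Omega> t"
  shows "vanishing_poly (U i :: 'a::{finite,field} mpoly set) ^ (CARD('a) ^ j) \<in> qspan (\<Inter>i\<in>\<Omega>. U i) (sum s \<Omega>)"
proof -
  let ?X = "\<Inter>i\<in>\<Omega>. U i"
  have ne: "\<Omega> \<noteq> {}" and i: "i \<in> I" using assms(2,3) by auto
  note D = admissibleD[OF adm] and X = admissible_Inter[OF adm assms(2) ne]
  have sub: "?X \<subseteq> U i" using assms(3) by auto
  have "vanishing_poly (U i) \<in> qspan ?X (Suc (qdim (U i) - qdim ?X))"
    by (intro vanishing_poly_mem_qspan D i X sub)
  then have "vanishing_poly (U i) ^ (CARD('a) ^ j) \<in> qspan ?X (Suc (qdim (U i) - qdim ?X) + j)"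
    by (rule qspan_power)
  moreover have "Suc (qdim (U i) - qdim ?X) + j \<le> sum s \<Omega>"
  proof -
    have "qdim ?X \<le> qdim (U i)" by (intro qdim_mono D i X sub)
    moreover have "t \<le> r i" "sum s \<Omega> + qdim ?X + t = k" using tight assms(3) by (auto simp: tight_def)
    ultimately show ?thesis using D(5)[OF i] assms(4) by linarith
  qed
  ultimately show ?thesis by (rule qspan_mono)
qed

theorem admissible_imp_family_indep:
  "admissible k I U r s \<Longrightarrow> family_indep I U s"
\<comment> \<open>Dropping an empty family or merging lowers \<open>card I\<close>, the decrease
  lowers \<open>k\<close>, and the cut lowers the sum of dimensions; no step raises a
  summand.\<close>
proof (induction "k + card I + (\<Sum>i\<in>I. qdim (U i))" arbitrary: k I U r s rule: less_induct)
  case less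
  note adm = less.prems
  note D = admissibleD[OF adm]
  consider (zero) i where "i \<in> I" "s i = 0"
    | (decrease) i0 where "i0 \<in> I" "0 < s i0" "\<And>i. i \<in> I \<Longrightarrow> i \<noteq> i0 \<Longrightarrow> 0 < r i"
    | (tight) \<Omega> t where "\<Omega> \<subset> I" "2 \<le> card \<Omega>" "tight k U r s \<Omega> t"
    | (empty) "I = {}"
    | (cut) i1 i2 where "i1 \<in> I" "i2 \<in> I" "i1 \<noteq> i2" "r i1 = 0" "r i2 = 0" "0 < s i1" "0 < s i2"
        "\<And>\<Omega> t. \<Omega> \<subset> I \<Longrightarrow> 2 \<le> card \<Omega> \<Longrightarrow> \<not> tight k U r s \<Omega> t"
  proof (cases "(\<exists>i\<in>I. s i = 0) \<or> (\<exists>i0\<in>I. 0 < s i0 \<and> (\<forall>i\<in>I. i \<noteq> i0 \<longrightarrow> 0 < r i)) \<or>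
      (\<exists>\<Omega> t. \<Omega> \<subset> I \<and> 2 \<le> card \<Omega> \<and> tight k U r s \<Omega> t) \<or> I = {}")
    case True
    then show ?thesis
      using zero decrease tight empty by (elim disjE bexE exE conjE) simp_all
  next
    case False
    then have pos: "0 < s i" if "i \<in> I" for i using that by auto
    have ex: "\<exists>i'\<in>I. i' \<noteq> i \<and> r i' = 0" if "i \<in> I" for i
      using False pos[OF that] that by (metis neq0_conv)
    \<comment> \<open>\<open>ex\<close> is used twice: at an arbitrary index to find one with r = 0,
      then at that index to find a second.\<close>
    obtain i where "i \<in> I" using False by auto
    then obtain i1 where i1: "i1 \<in> I" "r i1 = 0" using ex by auto
    then obtain i2 where i2: "i2 \<in> I" "i2 \<noteq> i1" "r i2 = 0" using ex by auto
    have slack: "\<not> tight k U r s \<Omega> t" if "\<Omega> \<subset> I" "2 \<le> card \<Omega>" for \<Omega> t using False that by simp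
    show ?thesis
      by (rule cut[OF i1(1) i2(1) i2(2)[symmetric] i1(2) i2(3) pos[OF i1(1)] pos[OF i2(1)] slack])
  qed
  then show ?case
  proof cases
    case zero
    have "card (I - {i}) < card I" using D(1) zero by (intro psubset_card_mono) auto
    moreover have "(\<Sum>i\<in>I - {i}. qdim (U i)) \<le> (\<Sum>i\<in>I. qdim (U i))"
      using D(1) by (intro sum_mono2) auto
    ultimately have "family_indep (I - {i}) U s"
      by (intro less.hyps[OF _ admissible_subset[OF adm]]) auto
    then show ?thesis by (rule family_indep_remove[where s = s and i = i, OF D(1) zero(2)])
  next
    case decrease
    let ?s = "if r i0 = 0 then s(i0 := s i0 - 1) else s"
    have "0 < k" using D(5)[OF decrease(1)] decrease(2) by linarith
    then have indep: "family_indep I U ?s"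
      by (intro less.hyps[OF _ admissible_decrease[OF adm decrease]]) auto
    show ?thesis
    proof (cases "r i0 = 0")
      case True
      have indep': "family_indep I U (s(i0 := s i0 - 1))" using indep True by simp
      have less: "s i + qdim (U i) < k" if "i \<in> I" "i \<noteq> i0" for i
        using D(5)[OF that(1)] decrease(3)[OF that] by linarith
      have top: "s i0 = Suc (s i0 - 1)" "Suc (s i0 - 1) + qdim (U i0) = k"
        using D(5)[OF decrease(1)] decrease(2) True by simp_all
      show ?thesis
        by (rule family_indep_top[OF D(1) decrease(1) D(2,3) top less indep'])
    qed (use indep in simp)
  next
    case tight
    then obtain i0 where i0: "i0 \<in> \<Omega>" by fastforce
    have sub: "\<Omega> \<subseteq> I" using tight by auto
    have fin: "finite \<Omega>" using sub D(1) finite_subset by blast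
    have ne: "\<Omega> \<noteq> {}" using i0 by auto
    let ?X = "\<Inter>i\<in>\<Omega>. U i" and ?I = "insert i0 (I - \<Omega>)"
    have split: "(\<Sum>i\<in>I. qdim (U i)) = (\<Sum>i\<in>I - \<Omega>. qdim (U i)) + (\<Sum>i\<in>\<Omega>. qdim (U i))"
      by (rule sum.subset_diff[OF sub D(1)])
    have card: "card I = card (I - \<Omega>) + card \<Omega>"
      using card_Diff_subset[OF fin sub] card_mono[OF D(1) sub] by linarith
    have "0 < card (I - \<Omega>)" using tight(1) D(1) by (auto simp: card_gt_0_iff)
    then have 1: "family_indep \<Omega> U s"
      using card split by (intro less.hyps[OF _ admissible_subset[OF adm sub]]) auto
    have "(\<Sum>i\<in>?I. qdim ((U(i0 := ?X)) i)) = qdim ?X + (\<Sum>i\<in>I - \<Omega>. qdim (U i))"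
    proof -
      have "(\<Sum>i\<in>I - \<Omega>. qdim ((U(i0 := ?X)) i)) = (\<Sum>i\<in>I - \<Omega>. qdim (U i))"
        using i0 by (intro sum.cong) auto
      then show ?thesis using i0 D(1) by (simp del: fun_upd_apply) simp
    qed
    moreover have "qdim ?X \<le> qdim (U i0)"
      using i0 sub by (intro qdim_mono D admissible_Inter[OF adm sub ne]) auto
    moreover have "qdim (U i0) \<le> (\<Sum>i\<in>\<Omega>. qdim (U i))"
      using member_le_sum[OF i0, of "\<lambda>i. qdim (U i)"] fin by simp
    moreover have "card ?I = Suc (card (I - \<Omega>))" using i0 D(1) by simp
    ultimately have "k + card ?I + (\<Sum>i\<in>?I. qdim ((U(i0 := ?X)) i)) < k + card I + (\<Sum>i\<in>I. qdim (U i))"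
      using card split tight(2) by linarith
    then have 2: "family_indep ?I (U(i0 := ?X)) (s(i0 := sum s \<Omega>))"
      by (rule less.hyps[OF _ admissible_merge[OF adm sub i0 tight(3)]])
    show ?thesis
      by (rule family_indep_merge[OF D(1) sub i0 tight_mem_qspan[OF adm sub _ _ tight(3)] 1 2])
  next
    case empty
    then show ?thesis by (simp add: family_indep_def)
  next
    case cut
    \<comment> \<open>Otherwise the pair constraint reads s_1 + s_2 + dim U_2 <= k, whereas s_2 +
      dim U_2 = k because r_2 = 0, and s_1 > 0.\<close>
    have "\<not> U i2 \<subseteq> U i1"
    proof
      assume "U i2 \<subseteq> U i1"
      then have "(\<Inter>i\<in>{i1, i2}. U i) = U i2" by auto
      moreover have "sum s {i1, i2} + qdim (\<Inter>i\<in>{i1, i2}. U i) + 0 \<le> k"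
        using cut by (intro D(6)) auto
      ultimately show False using cut D(5)[OF cut(2)] by simp
    qed
    then obtain x where x: "x \<in> U i2" "x \<notin> U i1" by auto
    obtain g where "Fq_functional g" and g: "\<And>y. y \<in> U i1 \<Longrightarrow> g y = 0" "g x = 1"
      using exists_separating_functional[OF D(3)[OF cut(1)] x(2)] by blast
    interpret Fq_functional g by fact
    have ker: "U i1 \<subseteq> ker" "\<not> U i2 \<subseteq> ker" using g x by (auto simp: ker_def)
    have "(\<Sum>i\<in>I. qdim (U i \<inter> ker)) < (\<Sum>i\<in>I. qdim (U i))"
    proof (rule sum_strict_mono_ex1[OF D(1)])
      show "\<forall>i\<in>I. qdim (U i \<inter> ker) \<le> qdim (U i)"
        using D(2,3) subspace_ker by (auto intro!: qdim_mono Fq.subspace_inter)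
      show "\<exists>i\<in>I. qdim (U i \<inter> ker) < qdim (U i)"
        using qdim_ker[OF D(2,3)[OF cut(2)] ker(2)] cut(2) by (intro bexI[of _ i2]) auto
    qed
    then have "family_indep I (\<lambda>i. U i \<inter> ker) s"
      by (intro less.hyps[OF _ admissible_ker[OF adm cut(1) cut(4) ker(1) cut(8)]]) auto
    with D(1-4) show ?thesis by (rule family_indep_ker)
  qed
qed

section \<open>Choice of one Frobenius power per subspace\<close>

definition indep_family :: "'i set \<Rightarrow> ('i \<Rightarrow> 'r::idom poly) \<Rightarrow> bool" where
  "indep_family I f \<longleftrightarrow> (\<forall>a. (\<Sum>i\<in>I. Polynomial.smult (a i) (f i)) = 0 \<longrightarrow> (\<forall>i\<in>I. a i = 0))"

lemma indep_familyD:
  assumes "indep_family I f" "(\<Sum>i\<in>I. Polynomial.smult (a i) (f i)) = 0" "i \<in> I"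
  shows "a i = 0"
  using assms(1)[unfolded indep_family_def, rule_format, of a, OF assms(2,3)] .

lemma indep_familyI:
  assumes "\<And>a i. (\<Sum>i\<in>I. Polynomial.smult (a i) (f i)) = 0 \<Longrightarrow> i \<in> I \<Longrightarrow> a i = 0"
  shows "indep_family I f"
  unfolding indep_family_def by (intro allI impI ballI) (rule assms)

lemma sum_fun_upd_smult:
  assumes "finite I" "i0 \<in> I"
  shows "(\<Sum>i\<in>I. Polynomial.smult (a i) ((f(i0 := p)) i)) =
    Polynomial.smult (a i0) p + (\<Sum>i\<in>I - {i0}. Polynomial.smult (a i) (f i))"
proof -
  have "(\<Sum>i\<in>I - {i0}. Polynomial.smult (a i) ((f(i0 := p)) i)) = (\<Sum>i\<in>I - {i0}. Polynomial.smult (a i) (f i))"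
    by (intro sum.cong) auto
  then show ?thesis
    using sum.remove[OF assms, of "\<lambda>i. Polynomial.smult (a i) ((f(i0 := p)) i)"] by simp
qed

text \<open>A relation witnessing failure must involve index \<open>i0\<close>, or it would
  contradict \<open>indep\<close>. Two such relations, one with \<open>p\<close> and one with
  \<open>r\<close>, combine into a nontrivial one with p - c r.\<close>

lemma indep_family_exchange:
  fixes f :: "'i \<Rightarrow> 'r::idom poly"
  assumes "finite I" "i0 \<in> I" and indep: "indep_family I (f(i0 := p - Polynomial.smult c r))"
  shows "indep_family I (f(i0 := p)) \<or> indep_family I (f(i0 := r))"
proof (rule ccontr)
  assume "\<not> ?thesis"
  then obtain a i b i' where
    a: "(\<Sum>i\<in>I. Polynomial.smult (a i) ((f(i0 := p)) i)) = 0" "i \<in> I" "a i \<noteq> 0" and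
    b: "(\<Sum>i\<in>I. Polynomial.smult (b i) ((f(i0 := r)) i)) = 0" "i' \<in> I" "b i' \<noteq> 0"
    unfolding indep_family_def de_Morgan_disj not_all not_imp Ball_def by (elim exE conjE)
  let ?S = "\<lambda>a. \<Sum>i\<in>I - {i0}. Polynomial.smult (a i) (f i)"
  have nz: "a i0 \<noteq> 0" if "Polynomial.smult (a i0) x + ?S a = 0" "i \<in> I" "a i \<noteq> 0" for a i x
  proof
    assume 0: "a i0 = 0"
    then have "(\<Sum>i\<in>I. Polynomial.smult (a i) ((f(i0 := p - Polynomial.smult c r)) i)) = 0"
      unfolding sum_fun_upd_smult[OF assms(1,2)] using that(1) by simp
    from indep_familyD[OF indep this that(2)] that(3) show False by simp
  qed
  have a': "Polynomial.smult (a i0) p + ?S a = 0"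
    using a(1) unfolding sum_fun_upd_smult[OF assms(1,2)] .
  have b': "Polynomial.smult (b i0) r + ?S b = 0"
    using b(1) unfolding sum_fun_upd_smult[OF assms(1,2)] .
  \<comment> \<open>This is b_i0 times the first relation minus c a_i0 times the second:
    cross-multiplication, since the coefficients form only a domain.\<close>
  define d where "d i = (if i = i0 then a i0 * b i0 else b i0 * a i - c * a i0 * b i)" for i
  have "?S d = (\<Sum>i\<in>I - {i0}. Polynomial.smult (b i0) (Polynomial.smult (a i) (f i)) -
      Polynomial.smult (c * a i0) (Polynomial.smult (b i) (f i)))"
    by (intro sum.cong) (auto simp: d_def smult_diff_left)
  also have "\<dots> = Polynomial.smult (b i0) (?S a) - Polynomial.smult (c * a i0) (?S b)"
    by (simp only: sum_subtractf smult_sum2)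
  also have "?S a = - Polynomial.smult (a i0) p" using a' by (simp add: eq_neg_iff_add_eq_0 add.commute)
  also have "?S b = - Polynomial.smult (b i0) r" using b' by (simp add: eq_neg_iff_add_eq_0 add.commute)
  finally have "Polynomial.smult (d i0) (p - Polynomial.smult c r) + ?S d = 0"
    by (simp add: d_def smult_diff_right mult_ac)
  then have "(\<Sum>i\<in>I. Polynomial.smult (d i) ((f(i0 := p - Polynomial.smult c r)) i)) = 0"
    unfolding sum_fun_upd_smult[OF assms(1,2)] .
  from indep_familyD[OF indep this assms(2)] have "a i0 * b i0 = 0" by (simp add: d_def)
  with nz[OF a' a(2,3)] nz[OF b' b(2,3)] show False by simp
qed

lemma lookup_const_poly_mult:
  "Poly_Mapping.lookup (const_poly c * x) m = c * Poly_Mapping.lookup x m"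
proof -
  have "const_poly c * x = Poly_Mapping.map ((*) c) x"
    unfolding const_poly_def by (rule mult_map_scale_conv_mult[symmetric])
  then show ?thesis by (simp add: Poly_Mapping.map.rep_eq when_def)
qed

section \<open>Enlarging subspaces by fresh variables\<close>

lemma exists_fresh_variable:
  assumes "finite S"
  obtains W N where "Fq.subspace W" "S \<subseteq> W" "(Zvar N :: 'a::field mpoly) \<notin> W"
proof -
  have "finite (\<Union>x\<in>S. Poly_Mapping.keys x)" using assms by simp
  moreover have "infinite (range (\<lambda>N::nat. Poly_Mapping.single N (1::nat)))"
    by (rule range_inj_infinite) (auto simp: inj_on_def dest!: arg_cong[where f = Poly_Mapping.keys])
  ultimately have "\<not> range (\<lambda>N::nat. Poly_Mapping.single N (1::nat)) \<subseteq> (\<Union>x\<in>S. Poly_Mapping.keys x)"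
    using finite_subset by blast
  then obtain N where N: "Poly_Mapping.single N (1::nat) \<notin> (\<Union>x\<in>S. Poly_Mapping.keys x)" by blast
  \<comment> \<open>A hyperplane containing all of \<open>S\<close> and missing Z_N. It certifies
    independence from all the given spaces at once.\<close>
  define W where "W = {x :: 'a mpoly. Poly_Mapping.lookup x (Poly_Mapping.single N 1) = 0}"
  have "Fq.subspace W"
    by (rule Fq.subspaceI) (auto simp: W_def lookup_add lookup_const_poly_mult)
  moreover have "S \<subseteq> W" using N by (auto simp: W_def in_keys_iff)
  moreover have "Zvar N \<notin> W" by (simp add: W_def Zvar_def)
  ultimately show ?thesis using that by blast
qed

lemma adjoin_Int_eq:
  assumes "Fq.subspace W" "u \<notin> W" "H \<subseteq> W" "T \<subseteq> W"
  shows "adjoin H u \<inter> T = H \<inter> T"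
proof
  show "adjoin H u \<inter> T \<subseteq> H \<inter> T"
  proof
    fix x assume x: "x \<in> adjoin H u \<inter> T"
    then obtain h c where hc: "h \<in> H" "x = h + const_poly c * u" by (auto simp: adjoin_def)
    have "x - h \<in> W" using x hc assms by (intro Fq.subspace_diff) auto
    then have "const_poly c * u \<in> W" using hc by simp
    from Fq.subspace_scale[OF assms(1) this, of "inverse c"]
    have "const_poly (inverse c * c) * u \<in> W" by (simp only: const_poly_simps mult.assoc)
    then have "c = 0" using assms(2) by (cases "c = 0") (auto simp del: const_poly_simps(4))
    with x hc show "x \<in> H \<inter> T" by simp
  qed
qed (use subset_adjoin in blast)

lemma Zvar_mem_linear_forms: "Zvar j \<in> linear_forms"
  unfolding linear_forms_def by (intro Fq.span_base) auto

lemma subspace_linear_forms: "Fq.subspace linear_forms"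
  unfolding linear_forms_def by (rule Fq.subspace_span)

text \<open>Subspaces of codimension at least two are enlarged by fresh variables until all have dimension \<open>k - 1\<close>;
  the polynomial of an enlarged space is a combination of two powers of the original one, one of which
  can be exchanged for it.\<close>
theorem exists_indep_vanishing_powers:
  fixes U :: "'i \<Rightarrow> 'a::{finite,field} mpoly set"
  assumes "finite I"
    and "\<And>i. i \<in> I \<Longrightarrow> finite (U i)" "\<And>i. i \<in> I \<Longrightarrow> Fq.subspace (U i)" "\<And>i. i \<in> I \<Longrightarrow> U i \<subseteq> linear_forms"
    and "\<And>\<Omega>. \<Omega> \<subseteq> I \<Longrightarrow> \<Omega> \<noteq> {} \<Longrightarrow> card \<Omega> + qdim (\<Inter>i\<in>\<Omega>. U i) \<le> k"
  shows "\<exists>j. (\<forall>i\<in>I. j i + qdim (U i) < k) \<and> indep_family I (\<lambda>i. vanishing_poly (U i) ^ (CARD('a) ^ j i))"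
  using assms
\<comment> \<open>The measure bottoms out when every space has dimension k - 1; the constraint for a
  singleton rules out dimension k.\<close>
proof (induction "\<Sum>i\<in>I. k - qdim (U i)" arbitrary: U rule: less_induct)
  case less
  note U = less.prems(2-4) and cond = less.prems(5)
  have single: "qdim (U i) < k" if "i \<in> I" for i using cond[of "{i}"] that by simp
  show ?case
  proof (cases "\<forall>i\<in>I. Suc (qdim (U i)) = k")
    case True
    \<comment> \<open>In dimension k - 1 there is room for exactly one power, s = 1 with r = 0, and
      the hypothesis on intersections becomes admissibility.\<close>
    have "admissible k I U (\<lambda>_. 0) (\<lambda>_. 1)"
      unfolding admissible_def
    proof (intro conjI ballI allI impI)
      fix \<Omega> and t :: nat assume "\<Omega> \<subseteq> I" "\<Omega> \<noteq> {}" "\<forall>i\<in>\<Omega>. t \<le> 0"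
      then show "sum (\<lambda>_. 1) \<Omega> + qdim (\<Inter>i\<in>\<Omega>. U i) + t \<le> k" using cond[of \<Omega>] by auto
    qed (use U \<open>finite I\<close> True in auto)
    then have indep: "family_indep I U (\<lambda>_. 1)" by (rule admissible_imp_family_indep)
    have "indep_family I (\<lambda>i. vanishing_poly (U i) ^ (CARD('a) ^ 0))"
    proof (rule indep_familyI)
      fix a i assume "(\<Sum>i\<in>I. Polynomial.smult (a i) (vanishing_poly (U i) ^ (CARD('a) ^ 0))) = 0" "i \<in> I"
      then have "(\<Sum>i\<in>I. \<Sum>j<1. Polynomial.smult (a i) (vanishing_poly (U i) ^ (CARD('a) ^ j))) = 0"
        by simp
      from family_indepD[OF indep this] \<open>i \<in> I\<close> show "a i = 0" by blast
    qed
    with single show ?thesis by (intro exI[of _ "\<lambda>_. 0"] conjI) simp_all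
  next
    case False
    then obtain i0 where i0: "i0 \<in> I" "Suc (qdim (U i0)) < k" using single by (metis Suc_lessI)
    have "finite (\<Union>i\<in>I. U i)" using U \<open>finite I\<close> by auto
    then obtain W N where W: "Fq.subspace W" "(\<Union>i\<in>I. U i) \<subseteq> W" "(Zvar N :: 'a mpoly) \<notin> W"
      by (rule exists_fresh_variable)
    define w where "w = (Zvar N :: 'a mpoly)"
    let ?U = "U(i0 := adjoin (U i0) w)"
    have w: "w \<notin> W" "w \<notin> U i0" using W i0 by (auto simp: w_def)
    have qdim': "qdim (?U i0) = Suc (qdim (U i0))"
      using qdim_adjoin[OF U(1,2)[OF i0(1)] w(2)] by simp
    \<comment> \<open>As soon as another space takes part, the intersection lies in
      \<open>W\<close>, where no vector involving the fresh variable survives.\<close>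
    have Int: "(\<Inter>i\<in>\<Omega>. ?U i) = (\<Inter>i\<in>\<Omega>. U i)" if \<Omega>: "\<Omega> \<subseteq> I" "\<Omega> \<noteq> {i0}" for \<Omega>
    proof (cases "i0 \<in> \<Omega>")
      case True
      define \<Omega>1 where "\<Omega>1 = \<Omega> - {i0}"
      have \<Omega>1: "\<Omega> = insert i0 \<Omega>1" "i0 \<notin> \<Omega>1" "\<Omega>1 \<noteq> {}" "\<Omega>1 \<subseteq> I"
        using True \<Omega> by (auto simp: \<Omega>1_def)
      have eq: "(\<Inter>i\<in>\<Omega>1. ?U i) = (\<Inter>i\<in>\<Omega>1. U i)" using \<Omega>1(2) by auto
      have "(\<Inter>i\<in>\<Omega>1. U i) \<subseteq> W" using W(2) \<Omega>1(3,4) by blast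
      then have "adjoin (U i0) w \<inter> (\<Inter>i\<in>\<Omega>1. U i) = U i0 \<inter> (\<Inter>i\<in>\<Omega>1. U i)"
        using W(1,2) w(1) i0(1) by (intro adjoin_Int_eq[of W]) auto
      then show ?thesis unfolding \<Omega>1(1) INT_insert eq by simp
    qed auto
    have "(\<Sum>i\<in>I. k - qdim (?U i)) < (\<Sum>i\<in>I. k - qdim (U i))"
    proof (rule sum_strict_mono_ex1[OF \<open>finite I\<close>])
      show "\<forall>i\<in>I. k - qdim (?U i) \<le> k - qdim (U i)"
      proof
        show "k - qdim (?U i) \<le> k - qdim (U i)" for i using qdim' by (cases "i = i0") simp_all
      qed
      show "\<exists>i\<in>I. k - qdim (?U i) < k - qdim (U i)"
        using i0 qdim' by (intro bexI[of _ i0]) simp_all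
    qed
    then have "\<exists>j. (\<forall>i\<in>I. j i + qdim (?U i) < k) \<and> indep_family I (\<lambda>i. vanishing_poly (?U i) ^ (CARD('a) ^ j i))"
    proof (rule less.hyps)
      fix i assume i: "i \<in> I"
      show "finite (?U i)" "Fq.subspace (?U i)"
        using U[OF i] by (auto intro: finite_adjoin subspace_adjoin)
      show "?U i \<subseteq> linear_forms"
        using U[OF i] adjoin_subset[OF subspace_linear_forms _ Zvar_mem_linear_forms, of "U i" N]
        by (auto simp: w_def)
    next
      fix \<Omega> assume \<Omega>: "\<Omega> \<subseteq> I" "\<Omega> \<noteq> {}"
      show "card \<Omega> + qdim (\<Inter>i\<in>\<Omega>. ?U i) \<le> k"
      proof (cases "\<Omega> = {i0}")
        case True
        then show ?thesis using qdim' i0(2) by simp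
      next
        case False
        show ?thesis unfolding Int[OF \<Omega>(1) False] by (rule cond[OF \<Omega>])
      qed
    qed (rule \<open>finite I\<close>)
    then obtain j where j: "\<forall>i\<in>I. j i + qdim (?U i) < k"
      and indep: "indep_family I (\<lambda>i. vanishing_poly (?U i) ^ (CARD('a) ^ j i))" by blast
    define c where "c = poly (vanishing_poly (U i0)) w ^ (CARD('a) - 1)"
    define f where "f i = vanishing_poly (U i) ^ (CARD('a) ^ j i)" for i
    have vp: "vanishing_poly (?U i0) = vanishing_poly (U i0) ^ CARD('a) - Polynomial.smult c (vanishing_poly (U i0))"
      using U[OF i0(1)] w(2) q_linear_vanishing_poly[of "U i0"] by (simp add: vanishing_poly_adjoin c_def)
    have diff: "(x - y) ^ (CARD('a) ^ m) = x ^ (CARD('a) ^ m) - y ^ (CARD('a) ^ m)" for x y :: "'a mpoly poly" and m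
      using mpoly_poly_power_card_add[of "x - y" y m] by (simp add: eq_diff_eq)
    \<comment> \<open>Frobenius preserves the two-term split, which exhibits \<open>j i0 + 1\<close>
      and \<open>j i0\<close> as the candidate exponents for the original space.\<close>
    have "vanishing_poly (?U i0) ^ (CARD('a) ^ j i0) = vanishing_poly (U i0) ^ (CARD('a) ^ Suc (j i0)) -
        Polynomial.smult (c ^ (CARD('a) ^ j i0)) (f i0)"
      unfolding vp diff by (simp add: f_def power_mult smult_power)
    then have eq: "(\<lambda>i. vanishing_poly (?U i) ^ (CARD('a) ^ j i)) =
        f(i0 := vanishing_poly (U i0) ^ (CARD('a) ^ Suc (j i0)) - Polynomial.smult (c ^ (CARD('a) ^ j i0)) (f i0))"
      by (auto simp: f_def fun_eq_iff)
    have "indep_family I (f(i0 := vanishing_poly (U i0) ^ (CARD('a) ^ Suc (j i0)) -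
        Polynomial.smult (c ^ (CARD('a) ^ j i0)) (f i0)))" by (rule indep[unfolded eq])
    from indep_family_exchange[OF \<open>finite I\<close> i0(1) this]
    have alt: "indep_family I (\<lambda>i. vanishing_poly (U i) ^ (CARD('a) ^ (j(i0 := Suc (j i0))) i)) \<or>
      indep_family I (\<lambda>i. vanishing_poly (U i) ^ (CARD('a) ^ j i))"
    proof (rule disj_forward)
      assume "indep_family I (f(i0 := vanishing_poly (U i0) ^ (CARD('a) ^ Suc (j i0))))"
      moreover have "f(i0 := vanishing_poly (U i0) ^ (CARD('a) ^ Suc (j i0))) =
          (\<lambda>i. vanishing_poly (U i) ^ (CARD('a) ^ (j(i0 := Suc (j i0))) i))"
        by (auto simp: f_def fun_eq_iff)
      ultimately show "indep_family I (\<lambda>i. vanishing_poly (U i) ^ (CARD('a) ^ (j(i0 := Suc (j i0))) i))" by (simp only:)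
    next
      assume "indep_family I (f(i0 := f i0))"
      moreover have "f(i0 := f i0) = (\<lambda>i. vanishing_poly (U i) ^ (CARD('a) ^ j i))"
        by (auto simp: f_def fun_eq_iff)
      ultimately show "indep_family I (\<lambda>i. vanishing_poly (U i) ^ (CARD('a) ^ j i))" by (simp only:)
    qed
    \<comment> \<open>The enlarged space has one more dimension, which leaves exactly the room
      needed for the larger exponent.\<close>
    have j12: "(j(i0 := Suc (j i0))) i + qdim (U i) < k" "j i + qdim (U i) < k" if "i \<in> I" for i
      using j[rule_format, OF that] qdim' by (cases "i = i0"; simp)+
    from alt show ?thesis
    proof (elim disjE)
      assume "indep_family I (\<lambda>i. vanishing_poly (U i) ^ (CARD('a) ^ (j(i0 := Suc (j i0))) i))"
      then show ?thesis by (intro exI[of _ "j(i0 := Suc (j i0))"] conjI ballI j12(1))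
    next
      assume "indep_family I (\<lambda>i. vanishing_poly (U i) ^ (CARD('a) ^ j i))"
      then show ?thesis by (intro exI[of _ j] conjI ballI j12(2))
    qed
  qed
qed

section \<open>Vectors as linear forms\<close>

lemma ex1_unique: "\<exists>!x. P x \<Longrightarrow> P a \<Longrightarrow> P b \<Longrightarrow> a = b"
  by blast

text \<open>Bridge from the algebraic dimension of the definitions to cardinality: coordinates in a
  basis give a bijection with the functions from the basis to F_q.\<close>

lemma card_vectorspace:
  assumes "vectorspace (class_ring :: 'a::{finite,field} ring) V" "finite (carrier V)"
  shows "card (carrier V) = CARD('a) ^ vectorspace.dim (class_ring :: 'a ring) V"
proof -
  interpret V: vectorspace "class_ring :: 'a ring" V by (rule assms(1))
  have "V.span (carrier V) = carrier V"
    using V.in_own_span[of "carrier V"] V.span_is_subset2[of "carrier V"] by auto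
  then have "V.fin_dim" using assms(2) unfolding V.fin_dim_def by blast
  then obtain B where B: "finite B" "V.basis B" using V.finite_basis_exists by blast
  have sub: "B \<subseteq> carrier V" using B(2) unfolding V.basis_def by blast
  have carr: "carrier (class_ring :: 'a ring) = UNIV" by (simp add: class_ring_simps)
  have ex1: "\<exists>!a. a \<in> B \<rightarrow>\<^sub>E (UNIV :: 'a set) \<and> V.lincomb a B = v" if "v \<in> carrier V" for v
    using V.basis_criterion[OF B(1) sub, THEN iffD1, OF B(2), rule_format, OF that] unfolding carr .
  have closed: "V.lincomb a B \<in> carrier V" for a
    using sub by (intro V.lincomb_closed) (auto simp: carr)
  have "bij_betw (\<lambda>a. V.lincomb a B) (B \<rightarrow>\<^sub>E (UNIV :: 'a set)) (carrier V)"
    unfolding bij_betw_def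
  proof (intro conjI inj_onI)
    show "(\<lambda>a. V.lincomb a B) ` (B \<rightarrow>\<^sub>E UNIV) = carrier V"
    proof
      show "carrier V \<subseteq> (\<lambda>a. V.lincomb a B) ` (B \<rightarrow>\<^sub>E UNIV)"
      proof
        fix v assume "v \<in> carrier V"
        from ex1[OF this] obtain a where "a \<in> B \<rightarrow>\<^sub>E UNIV" "V.lincomb a B = v" by (elim ex1E conjE)
        then show "v \<in> (\<lambda>a. V.lincomb a B) ` (B \<rightarrow>\<^sub>E UNIV)" by (intro image_eqI[of _ _ a]) simp_all
      qed
      show "(\<lambda>a. V.lincomb a B) ` (B \<rightarrow>\<^sub>E UNIV) \<subseteq> carrier V" by (intro image_subsetI closed)
    qed
    fix a b assume "a \<in> B \<rightarrow>\<^sub>E (UNIV :: 'a set)" "b \<in> B \<rightarrow>\<^sub>E (UNIV :: 'a set)" "V.lincomb a B = V.lincomb b B"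
    then show "a = b"
      by (intro ex1_unique[where P = "\<lambda>a. a \<in> B \<rightarrow>\<^sub>E UNIV \<and> V.lincomb a B = V.lincomb b B", OF ex1[OF closed]] conjI)
        simp_all
  qed
  then have "card (carrier V) = card (B \<rightarrow>\<^sub>E (UNIV :: 'a set))"
    by (rule bij_betw_same_card[symmetric])
  also have "\<dots> = CARD('a) ^ card B" using B(1) by (simp add: card_funcsetE)
  also have "card B = V.dim" using V.dim_basis[OF B] by simp
  finally show ?thesis .
qed

lemma carrier_vec_eq_image: "(carrier_vec n :: 'a vec set) = vec_of_list ` {xs. length xs = n}"
proof
  show "(carrier_vec n :: 'a vec set) \<subseteq> vec_of_list ` {xs. length xs = n}"
  proof
    fix v :: "'a vec" assume "v \<in> carrier_vec n"
    then show "v \<in> vec_of_list ` {xs. length xs = n}"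
      by (intro image_eqI[of _ _ "list_of_vec v"]) (auto simp: vec_list)
  qed
qed (auto intro: carrier_vecI)

lemma finite_carrier_vec: "finite (carrier_vec n :: 'a::finite vec set)"
  using finite_lists_length_eq[of "UNIV :: 'a set" n] by (simp add: carrier_vec_eq_image)

lemma card_carrier_vec: "card (carrier_vec n :: 'a::finite vec set) = CARD('a) ^ n"
proof -
  have "inj_on (vec_of_list :: 'a list \<Rightarrow> _) {xs. length xs = n}"
    by (rule inj_on_inverseI[of _ list_of_vec]) (simp add: list_vec)
  then have "card (carrier_vec n :: 'a vec set) = card {xs :: 'a list. length xs = n}"
    by (simp add: carrier_vec_eq_image card_image)
  then show ?thesis using card_lists_length_eq[of "UNIV :: 'a set" n] by simp
qed

lemma fq_subspaceD:
  assumes "fq_subspace n (W :: 'a::field vec set)"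
  shows "W \<subseteq> carrier_vec n" "0\<^sub>v n \<in> W" "x \<in> W \<Longrightarrow> y \<in> W \<Longrightarrow> x + y \<in> W" "x \<in> W \<Longrightarrow> c \<cdot>\<^sub>v x \<in> W"
proof -
  have "submodule (class_ring :: 'a ring) W (module_vec TYPE('a) n)"
    using assms unfolding fq_subspace_def VectorSpace.subspace_def by blast
  then interpret submodule "class_ring :: 'a ring" W "module_vec TYPE('a) n" .
  show "W \<subseteq> carrier_vec n" "0\<^sub>v n \<in> W" "x \<in> W \<Longrightarrow> y \<in> W \<Longrightarrow> x + y \<in> W" "x \<in> W \<Longrightarrow> c \<cdot>\<^sub>v x \<in> W"
    using subset zero_closed m_closed[of x y] smult_closed[of c x]
    by (simp_all add: module_vec_simps class_ring_simps)
qed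

lemma card_fq_subspace:
  assumes "fq_subspace n (W :: 'a::{finite,field} vec set)"
  shows "card W = CARD('a) ^ fq_dim n W"
proof -
  interpret vec_space "TYPE('a)" n .
  have "vectorspace (class_ring :: 'a ring) (module_vec TYPE('a) n\<lparr>carrier := W\<rparr>)"
    using assms unfolding fq_subspace_def by (rule subspace_is_vs)
  moreover have "finite W"
    using fq_subspaceD(1)[OF assms] finite_carrier_vec finite_subset by blast
  ultimately show ?thesis
    using card_vectorspace[of "module_vec TYPE('a) n\<lparr>carrier := W\<rparr>"] by (simp add: fq_dim_def)
qed

lemma fq_subspace_INT:
  assumes "\<Omega> \<noteq> {}" "\<And>i. i \<in> \<Omega> \<Longrightarrow> fq_subspace n (V i :: 'a::field vec set)"
  shows "fq_subspace n (\<Inter>i\<in>\<Omega>. V i)"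
proof -
  note D = fq_subspaceD[OF assms(2)]
  have "(\<Inter>i\<in>\<Omega>. V i) \<subseteq> carrier_vec n" using assms(1) D(1) by blast
  then have "submodule (class_ring :: 'a ring) (\<Inter>i\<in>\<Omega>. V i) (module_vec TYPE('a) n)"
    by (intro submodule.intro[OF vec_module])
      (use D in \<open>auto simp: module_vec_simps class_ring_simps\<close>)
  then show ?thesis unfolding fq_subspace_def by (intro VectorSpace.subspace.intro vec_vs)
qed

definition lform :: "nat \<Rightarrow> 'a::field vec \<Rightarrow> 'a mpoly" where
  "lform n x = (\<Sum>j<n. const_poly (x $ j) * Zvar j)"

lemma lform_add: "x \<in> carrier_vec n \<Longrightarrow> y \<in> carrier_vec n \<Longrightarrow> lform n (x + y) = lform n x + lform n y"
  by (simp add: lform_def sum.distrib algebra_simps)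

lemma lform_smult: "x \<in> carrier_vec n \<Longrightarrow> lform n (c \<cdot>\<^sub>v x) = const_poly c * lform n x"
  by (simp add: lform_def sum_distrib_left)

lemma lform_zero: "lform n (0\<^sub>v n) = 0"
  by (simp add: lform_def)

lemma lookup_lform: "j < n \<Longrightarrow> Poly_Mapping.lookup (lform n x) (Poly_Mapping.single j 1) = x $ j"
proof -
  assume j: "j < n"
  have inj: "Poly_Mapping.single i (Suc 0) = Poly_Mapping.single j (Suc 0) \<longleftrightarrow> i = j" for i j :: nat
    by (metis keys_single nat.distinct(1) singleton_inject)
  have "Poly_Mapping.lookup (lform n x) (Poly_Mapping.single j 1) = (\<Sum>i<n. if i = j then x $ i else 0)"
    unfolding lform_def lookup_sum
    by (intro sum.cong) (simp_all add: lookup_const_poly_mult Zvar_def lookup_single when_def inj)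
  then show ?thesis using j by simp
qed

lemma inj_on_lform: "inj_on (lform n) (carrier_vec n :: 'a::field vec set)"
proof (rule inj_onI)
  fix x y :: "'a vec" assume xy: "x \<in> carrier_vec n" "y \<in> carrier_vec n" "lform n x = lform n y"
  show "x = y"
  proof (rule eq_vecI)
    fix j assume "j < dim_vec y"
    then have "j < n" using xy(2) by simp
    then show "x $ j = y $ j" using lookup_lform[of j n x] lookup_lform[of j n y] xy(3) by simp
  qed (use xy in simp)
qed

lemma lform_mem_linear_forms: "lform n x \<in> linear_forms"
  unfolding lform_def
  by (intro Fq.subspace_sum subspace_linear_forms Fq.subspace_scale Zvar_mem_linear_forms)

lemma subspace_lform_image:
  assumes "fq_subspace n W"
  shows "Fq.subspace (lform n ` W)"
proof -
  note D = fq_subspaceD[OF assms]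
  show ?thesis
  proof (rule Fq.subspaceI)
    show "0 \<in> lform n ` W" using D(2) lform_zero[of n] by (metis image_eqI)
  next
    fix x y assume "x \<in> lform n ` W" "y \<in> lform n ` W"
    then obtain v w where "v \<in> W" "w \<in> W" "x = lform n v" "y = lform n w" by blast
    then show "x + y \<in> lform n ` W"
      using D(3) by (intro image_eqI[of _ _ "v + w"]) (auto simp: lform_add subsetD[OF D(1)])
  next
    fix c x assume "x \<in> lform n ` W"
    then obtain v where "v \<in> W" "x = lform n v" by blast
    then show "const_poly c * x \<in> lform n ` W"
      using D(4) by (intro image_eqI[of _ _ "c \<cdot>\<^sub>v v"]) (auto simp: lform_smult subsetD[OF D(1)])
  qed
qed

lemma qdim_lform_image:
  assumes "fq_subspace n (W :: 'a::{finite,field} vec set)"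
  shows "qdim (lform n ` W) = fq_dim n W"
proof (rule qdim_eqI)
  have "inj_on (lform n) W" by (rule inj_on_subset[OF inj_on_lform fq_subspaceD(1)[OF assms]])
  then show "card (lform n ` W) = CARD('a) ^ fq_dim n W"
    by (simp add: card_image card_fq_subspace[OF assms])
qed

lemma sum_mpoly_power_card:
  fixes f :: "'i \<Rightarrow> 'a::{finite,field} mpoly"
  shows "finite I \<Longrightarrow> (\<Sum>i\<in>I. f i) ^ (CARD('a) ^ j) = (\<Sum>i\<in>I. f i ^ (CARD('a) ^ j))"
  by (induction I rule: finite_induct) (simp_all add: mpoly_power_card_add card_gt_0_iff)

lemma lform_power_card:
  "lform n (x :: 'a::{finite,field} vec) ^ (CARD('a) ^ s) = (\<Sum>j<n. const_poly (x $ j) * Zvar j ^ (CARD('a) ^ s))"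
  by (simp add: lform_def sum_mpoly_power_card power_mult_distrib)

section \<open>Degree bounds\<close>

text \<open>Controls variables and degree together, monomial by monomial, so that closure under sums
  and products avoids the maximum in \<open>total_degree\<close>.\<close>

definition bounded_mpoly :: "nat \<Rightarrow> nat \<Rightarrow> 'a::field mpoly \<Rightarrow> bool" where
  "bounded_mpoly n N p \<longleftrightarrow>
    (\<forall>m\<in>Poly_Mapping.keys p. Poly_Mapping.keys m \<subseteq> {..<n} \<and> (\<Sum>j<n. Poly_Mapping.lookup m j) \<le> N)"

lemma bounded_mpoly_mono: "bounded_mpoly n N p \<Longrightarrow> N \<le> M \<Longrightarrow> bounded_mpoly n M p"
  unfolding bounded_mpoly_def by (meson le_trans)

lemma bounded_mpoly_0: "bounded_mpoly n N 0"
  by (simp add: bounded_mpoly_def)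

lemma bounded_mpoly_1: "bounded_mpoly n N 1"
  by (simp add: bounded_mpoly_def)

lemma bounded_mpoly_add: "bounded_mpoly n N p \<Longrightarrow> bounded_mpoly n N r \<Longrightarrow> bounded_mpoly n N (p + r)"
  unfolding bounded_mpoly_def using keys_add[of p r] by blast

lemma bounded_mpoly_uminus: "bounded_mpoly n N p \<Longrightarrow> bounded_mpoly n N (- p)"
  unfolding bounded_mpoly_def by (simp add: in_keys_iff)

lemma bounded_mpoly_sum: "(\<And>i. i \<in> I \<Longrightarrow> bounded_mpoly n N (f i)) \<Longrightarrow> bounded_mpoly n N (\<Sum>i\<in>I. f i)"
  by (induction I rule: infinite_finite_induct) (auto intro: bounded_mpoly_0 bounded_mpoly_add)

lemma bounded_mpoly_mult:
  assumes "bounded_mpoly n N p" "bounded_mpoly n M r"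
  shows "bounded_mpoly n (N + M) (p * r)"
  unfolding bounded_mpoly_def
proof
  fix m assume "m \<in> Poly_Mapping.keys (p * r)"
  then obtain a b where m: "m = a + b" "a \<in> Poly_Mapping.keys p" "b \<in> Poly_Mapping.keys r"
    using keys_mult[of p r] by blast
  then have a: "Poly_Mapping.keys a \<subseteq> {..<n}" "(\<Sum>j<n. Poly_Mapping.lookup a j) \<le> N"
    and b: "Poly_Mapping.keys b \<subseteq> {..<n}" "(\<Sum>j<n. Poly_Mapping.lookup b j) \<le> M"
    using assms unfolding bounded_mpoly_def by blast+
  show "Poly_Mapping.keys m \<subseteq> {..<n} \<and> (\<Sum>j<n. Poly_Mapping.lookup m j) \<le> N + M"
    using keys_add[of a b] a b by (simp add: m(1) lookup_add sum.distrib) blast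
qed

lemma bounded_mpoly_lform: "bounded_mpoly n 1 (lform n x)"
proof -
  have "bounded_mpoly n (0 + 1) (const_poly (x $ j) * Zvar j)" if "j < n" for j
    using that
    by (intro bounded_mpoly_mult) (auto simp: bounded_mpoly_def const_poly_def Zvar_def lookup_single when_def split: if_splits)
  then show ?thesis unfolding lform_def by (intro bounded_mpoly_sum) simp
qed

lemma bounded_mpoly_imp:
  assumes "bounded_mpoly n N p"
  shows "vars p \<subseteq> {..<n}" "total_degree p \<le> N"
proof -
  show "vars p \<subseteq> {..<n}" using assms by (auto simp: vars_def bounded_mpoly_def)
  have "(\<Sum>j\<in>Poly_Mapping.keys m. Poly_Mapping.lookup m j) \<le> N" if "m \<in> Poly_Mapping.keys p" for m
  proof -
    have "(\<Sum>j\<in>Poly_Mapping.keys m. Poly_Mapping.lookup m j) \<le> (\<Sum>j<n. Poly_Mapping.lookup m j)"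
      using assms that by (intro sum_mono2) (auto simp: bounded_mpoly_def)
    also have "\<dots> \<le> N" using assms that by (simp add: bounded_mpoly_def)
    finally show ?thesis .
  qed
  then show "total_degree p \<le> N" unfolding total_degree_def by (subst Max_le_iff) auto
qed

text \<open>Giving the variable of the outer polynomial weight one, this bounds the joint degree by \<open>D\<close>.\<close>
definition jointly_bounded :: "nat \<Rightarrow> nat \<Rightarrow> 'a::field mpoly poly \<Rightarrow> bool" where
  "jointly_bounded n D p \<longleftrightarrow> (\<forall>e. coeff p e \<noteq> 0 \<longrightarrow> e \<le> D \<and> bounded_mpoly n (D - e) (coeff p e))"

lemma jointly_bounded_mult:
  assumes "jointly_bounded n D p" "jointly_bounded n E r"
  shows "jointly_bounded n (D + E) (p * r)"
  unfolding jointly_bounded_def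
proof (intro allI impI)
  fix e assume nz: "coeff (p * r) e \<noteq> 0"
  have le: "i \<le> D \<and> e - i \<le> E" if "coeff p i * coeff r (e - i) \<noteq> 0" for i
    using that assms by (auto simp: jointly_bounded_def)
  have "\<exists>i\<le>e. coeff p i * coeff r (e - i) \<noteq> 0"
    using nz unfolding coeff_mult by (metis (no_types, lifting) atMost_iff sum.neutral)
  then have "e \<le> D + E" using le by fastforce
  moreover have "bounded_mpoly n (D + E - e) (coeff p i * coeff r (e - i))" if "i \<le> e" for i
  proof (cases "coeff p i * coeff r (e - i) = 0")
    case False
    then have nz: "coeff p i \<noteq> 0" "coeff r (e - i) \<noteq> 0" by auto
    have "bounded_mpoly n ((D - i) + (E - (e - i))) (coeff p i * coeff r (e - i))"
      using assms nz by (intro bounded_mpoly_mult) (simp_all add: jointly_bounded_def)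
    then show ?thesis using le[OF False] that by (rule_tac bounded_mpoly_mono) auto
  qed (auto simp: bounded_mpoly_0)
  ultimately show "e \<le> D + E \<and> bounded_mpoly n (D + E - e) (coeff (p * r) e)"
    unfolding coeff_mult by (intro conjI bounded_mpoly_sum) auto
qed

lemma jointly_bounded_1: "jointly_bounded n 0 1"
  by (auto simp: jointly_bounded_def bounded_mpoly_1 split: if_splits)

lemma jointly_bounded_power: "jointly_bounded n D p \<Longrightarrow> jointly_bounded n (D * m) (p ^ m)"
  by (induction m) (auto simp: jointly_bounded_1 intro: jointly_bounded_mult)

lemma jointly_bounded_vanishing_poly:
  assumes "\<And>x. x \<in> S \<Longrightarrow> bounded_mpoly n 1 x" "finite S"
  shows "jointly_bounded n (card S) (vanishing_poly S)"
  using assms(2,1) unfolding vanishing_poly_def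
proof (induction S rule: finite_induct)
  case (insert x S)
  have "jointly_bounded n 1 [:- x, 1:]"
    using insert.prems[of x]
    by (auto simp: jointly_bounded_def coeff_pCons bounded_mpoly_1 bounded_mpoly_uminus split: nat.splits)
  then have "jointly_bounded n (1 + card S) ([:- x, 1:] * (\<Prod>x\<in>S. [:- x, 1:]))"
    using insert by (intro jointly_bounded_mult) auto
  then show ?case using insert.hyps by simp
qed (simp add: jointly_bounded_1)

section \<open>Kernel patterns\<close>

lemma q_linear_poly_eq:
  fixes p :: "'a::{finite,field} mpoly poly"
  assumes "q_linear p" "degree p < CARD('a) ^ k"
  shows "poly p x = (\<Sum>s<k. coeff p (CARD('a) ^ s) * x ^ (CARD('a) ^ s))"
proof -
  let ?q = "CARD('a)"
  have q: "1 < ?q" using card_UNIV_ge_2[where 'a='a] by simp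
  have inj: "inj_on (\<lambda>s. ?q ^ s) {..<k}" using q by (intro inj_onI) simp
  have "poly p x = (\<Sum>e<?q ^ k. coeff p e * x ^ e)"
    unfolding poly_altdef using assms(2) by (intro sum.mono_neutral_left) (auto simp: coeff_eq_0)
  also have "\<dots> = (\<Sum>e\<in>(\<lambda>s. ?q ^ s) ` {..<k}. coeff p e * x ^ e)"
  proof (rule sum.mono_neutral_right)
    show "(\<lambda>s. ?q ^ s) ` {..<k} \<subseteq> {..<?q ^ k}" using q by (auto intro: power_strict_increasing)
    show "\<forall>e\<in>{..<?q ^ k} - (\<lambda>s. ?q ^ s) ` {..<k}. coeff p e * x ^ e = 0"
    proof
      fix e assume e: "e \<in> {..<?q ^ k} - (\<lambda>s. ?q ^ s) ` {..<k}"
      have "coeff p e = 0"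
      proof (rule ccontr)
        assume "coeff p e \<noteq> 0"
        then obtain s where s: "e = ?q ^ s" using assms(1) unfolding q_linear_def by blast
        then have "s < k" using e q by simp
        with s e show False by blast
      qed
      then show "coeff p e * x ^ e = 0" by simp
    qed
  qed simp
  also have "\<dots> = (\<Sum>s<k. coeff p (?q ^ s) * x ^ (?q ^ s))" by (simp add: sum.reindex[OF inj])
  finally show ?thesis .
qed

lemma to_fract_hom: "comm_ring_hom (to_fract :: 'b::idom \<Rightarrow> 'b fract)"
  by unfold_locales simp_all

text \<open>A linearized polynomial of degree below q^k is determined by its coefficients at
  X^(q^s), s < k. So a kernel vector of the transposed matrix is a relation among the f_i.\<close>

lemma det_coeffs_neq_0:
  fixes f :: "nat \<Rightarrow> 'a::{finite,field} mpoly poly"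
  assumes "indep_family {..<k} f"
    and lin: "\<And>i. i < k \<Longrightarrow> q_linear (f i)" and deg: "\<And>i. i < k \<Longrightarrow> degree (f i) < CARD('a) ^ k"
  shows "det (mat k k (\<lambda>(i, s). coeff (f i) (CARD('a) ^ s))) \<noteq> 0"
proof
  let ?M = "mat k k (\<lambda>(i, s). coeff (f i) (CARD('a) ^ s))"
  have M: "?M \<in> carrier_mat k k" by simp
  assume "det ?M = 0"
  then have "det (transpose_mat ?M) = 0" using det_transpose[OF M] by simp
  then obtain v where v: "v \<in> carrier_vec k" "v \<noteq> 0\<^sub>v k" "transpose_mat ?M *\<^sub>v v = 0\<^sub>v k"
    using det_0_iff_vec_prod_zero[of "transpose_mat ?M" k] by auto
  have "(\<Sum>i<k. Polynomial.smult (v $ i) (f i)) = 0"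
  proof (rule poly_eqI)
    fix e
    show "coeff (\<Sum>i<k. Polynomial.smult (v $ i) (f i)) e = coeff 0 e"
    proof (cases "\<exists>s<k. e = CARD('a) ^ s")
      case True
      then obtain s where s: "s < k" "e = CARD('a) ^ s" by blast
      have "(transpose_mat ?M *\<^sub>v v) $ s = (\<Sum>i<k. coeff (f i) e * v $ i)"
        using s v(1) by (simp add: scalar_prod_def atLeast0LessThan)
      with v(3) s(1) show ?thesis by (simp add: coeff_sum mult.commute)
    next
      case False
      have "coeff (f i) e = 0" if i: "i < k" for i
      proof (rule ccontr)
        assume nz: "coeff (f i) e \<noteq> 0"
        then obtain s where s: "e = CARD('a) ^ s" using lin[OF i] unfolding q_linear_def by blast
        have "e < CARD('a) ^ k" using le_degree[OF nz] deg[OF i] by simp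
        then have "s < k" using s card_UNIV_ge_2[where 'a='a] by simp
        with s False show False by blast
      qed
      then show ?thesis by (simp add: coeff_sum)
    qed
  qed
  then have "v $ i = 0" if "i < k" for i
    using indep_familyD[OF assms(1), of "\<lambda>i. v $ i" i] that by simp
  then have "v = 0\<^sub>v k" using v(1) by (intro eq_vecI) auto
  with v(2) show False by simp
qed

lemma det_neq_0_imp_invertible:
  assumes "A \<in> carrier_mat n n" "det A \<noteq> (0 :: 'b::field)"
  shows "invertible_mat A"
proof -
  have "A \<in> Units (ring_mat TYPE('b) n ())" using assms by (rule det_non_zero_imp_unit)
  then obtain B where "B \<in> carrier_mat n n" "A * B = 1\<^sub>m n" "B * A = 1\<^sub>m n"
    unfolding Units_def ring_mat_def by auto
  then show ?thesis
    using assms(1) unfolding invertible_mat_def inverts_mat_def square_mat.simps by auto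
qed

text \<open>Frobenius fixes the entries of \<open>A\<close>, so G times a column lists the powers
  L^(q^s) of its linear form L, and the row of \<open>M\<close> weights them with the coefficients
  of \<open>p\<close>.\<close>

lemma row_gab_lift_eq_poly:
  fixes p :: "'a::{finite,field} mpoly poly"
  assumes A: "A \<in> carrier_mat n d" and c: "c < d"
    and M: "M \<in> carrier_mat k k" and i: "i < k"
    and row: "\<And>s. s < k \<Longrightarrow> M $$ (i, s) = to_fract (coeff p (CARD('a) ^ s))"
    and p: "q_linear p" "degree p < CARD('a) ^ k"
  shows "(mat_of_row (row M i) * gab_matrix TYPE('a) k n * lift_mat A) $$ (0, c) =
    to_fract (poly p (lform n (col A c)))"
proof -
  let ?q = "CARD('a)"
  let ?G = "gab_matrix TYPE('a) k n"
  have "(mat_of_row (row M i) * ?G * lift_mat A) $$ (0, c) =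
      (\<Sum>l<n. (\<Sum>s<k. M $$ (i, s) * ?G $$ (s, l)) * lift_mat A $$ (l, c))"
    using A c M i by (simp add: scalar_prod_def gab_matrix_def lift_mat_def mat_of_row_def atLeast0LessThan)
  also have "\<dots> = (\<Sum>l<n. (\<Sum>s<k. to_fract (coeff p (?q ^ s) * Zvar l ^ (?q ^ s))) * to_fract (const_poly (A $$ (l, c))))"
    using A c row by (intro sum.cong refl arg_cong2[where f = "(*)"]) (auto simp: gab_matrix_def lift_mat_def emb_def)
  also have "\<dots> = to_fract (\<Sum>l<n. \<Sum>s<k. coeff p (?q ^ s) * (const_poly (A $$ (l, c)) * Zvar l ^ (?q ^ s)))"
    by (simp only: flip: to_fract_sum to_fract_mult) (simp add: sum_distrib_right sum_distrib_left mult_ac)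
  also have "(\<Sum>l<n. \<Sum>s<k. coeff p (?q ^ s) * (const_poly (A $$ (l, c)) * Zvar l ^ (?q ^ s))) =
      (\<Sum>s<k. coeff p (?q ^ s) * (\<Sum>l<n. const_poly (A $$ (l, c)) * Zvar l ^ (?q ^ s)))"
    by (subst sum.swap) (simp only: sum_distrib_left)
  also have "\<dots> = (\<Sum>s<k. coeff p (?q ^ s) * lform n (col A c) ^ (?q ^ s))"
    using A c by (simp add: lform_power_card)
  also have "\<dots> = poly p (lform n (col A c))" by (rule q_linear_poly_eq[OF p, symmetric])
  finally show ?thesis .
qed

lemma col_mem_col_span:
  assumes "A \<in> carrier_mat n d" "c < d"
  shows "col A c \<in> col_span n A"
proof -
  interpret vec_space "TYPE('a)" n .
  have "set (cols A) \<subseteq> carrier_vec n" using assms cols_dim[of A] by auto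
  moreover have "col A c \<in> set (cols A)" using assms by (auto simp: cols_def)
  ultimately show ?thesis unfolding col_span_def using in_own_span[of "set (cols A)"] by auto
qed

theorem gab_attains_pattern:
  fixes V :: "nat \<Rightarrow> 'a::{finite,field} vec set"
  assumes gen: "generic_kernel_pattern n k V"
    and A: "\<And>i. i < k \<Longrightarrow> A i \<in> carrier_mat n (fq_dim n (V i))" "\<And>i. i < k \<Longrightarrow> col_span n (A i) = V i"
  shows "\<exists>M \<in> carrier_mat k k. invertible_mat M \<and>
    (\<forall>i<k. mat_of_row (row M i) * gab_matrix TYPE('a) k n * lift_mat (A i) = 0\<^sub>m 1 (dim_col (A i))) \<and>
    (\<forall>i<k. \<forall>j<k. \<exists>p. M $$ (i,j) = to_fract p \<and> vars p \<subseteq> {..<n} \<and> total_degree p \<le> CARD('a) ^ (k - 1))"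
proof -
  let ?q = "CARD('a)"
  have q: "1 < ?q" using card_UNIV_ge_2[where 'a='a] by simp
  have V: "fq_subspace n (V i)" if "i < k" for i
    using gen that unfolding generic_kernel_pattern_def kernel_pattern_def by blast
  have dimV: "fq_dim n (\<Inter>i\<in>\<Omega>. V i) \<le> k - card \<Omega>" if "\<Omega> \<subseteq> {..<k}" "\<Omega> \<noteq> {}" for \<Omega>
    using gen that unfolding generic_kernel_pattern_def by blast
  define U where "U i = lform n ` V i" for i
  have finU: "finite (U i)" if "i < k" for i
    unfolding U_def using fq_subspaceD(1)[OF V[OF that]] finite_carrier_vec finite_subset by blast
  have subU: "Fq.subspace (U i)" if "i < k" for i
    unfolding U_def by (rule subspace_lform_image[OF V[OF that]])
  have "\<exists>j. (\<forall>i\<in>{..<k}. j i + qdim (U i) < k) \<and> indep_family {..<k} (\<lambda>i. vanishing_poly (U i) ^ (?q ^ j i))"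
  proof (rule exists_indep_vanishing_powers)
    fix \<Omega> assume \<Omega>: "\<Omega> \<subseteq> {..<k}" "\<Omega> \<noteq> {}"
    obtain i0 where i0: "i0 \<in> \<Omega>" using \<Omega>(2) by blast
    have "(\<Inter>i\<in>\<Omega>. U i) = lform n ` (\<Inter>i\<in>\<Omega>. V i)"
      unfolding U_def using \<Omega>(1) fq_subspaceD(1)[OF V]
      by (intro image_INT[OF inj_on_lform _ i0, symmetric]) blast
    also have "qdim \<dots> = fq_dim n (\<Inter>i\<in>\<Omega>. V i)"
      using \<Omega> V by (intro qdim_lform_image fq_subspace_INT) auto
    \<comment> \<open>The subtraction \<open>k - card \<Omega>\<close> is not truncated, because
      \<open>\<Omega>\<close> has at most k elements.\<close>
    finally show "card \<Omega> + qdim (\<Inter>i\<in>\<Omega>. U i) \<le> k"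
      using dimV[OF \<Omega>] card_mono[OF finite_lessThan \<Omega>(1)] by simp
  qed (use finU subU in \<open>auto simp: U_def lform_mem_linear_forms\<close>)
  then obtain j where j: "\<And>i. i < k \<Longrightarrow> j i + qdim (U i) < k"
    and indep: "indep_family {..<k} (\<lambda>i. vanishing_poly (U i) ^ (?q ^ j i))" by auto
  define f where "f i = vanishing_poly (U i) ^ (?q ^ j i)" for i
  have lin: "q_linear (f i)" if "i < k" for i
    unfolding f_def by (intro q_linear_power q_linear_vanishing_poly finU subU that)
  have card: "card (U i) * ?q ^ j i = ?q ^ (qdim (U i) + j i)" if "i < k" for i
    using card_eq_power_qdim[OF finU[OF that] subU[OF that]] by (simp add: power_add)
  have le: "?q ^ (qdim (U i) + j i) \<le> ?q ^ (k - 1)" if "i < k" for i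
    using j[OF that] q by (intro power_increasing) auto
  have deg: "degree (f i) < ?q ^ k" if "i < k" for i
  proof -
    have "degree (f i) = ?q ^ (qdim (U i) + j i)"
      using card[OF that] by (simp add: f_def degree_power_eq degree_vanishing_poly mult.commute)
    also have "\<dots> < ?q ^ k" using j[OF that] q by (intro power_strict_increasing) auto
    finally show ?thesis .
  qed
  \<comment> \<open>The product of the factors X - x, raised to q^j, has joint degree q^(dim + j) in
    X and the Z_j, which is at most q^(k-1) as dim + j < k.\<close>
  have bound: "bounded_mpoly n (?q ^ (k - 1)) (coeff (f i) e)" if "i < k" for i e
  proof (cases "coeff (f i) e = 0")
    case False
    have "jointly_bounded n (card (U i) * ?q ^ j i) (f i)"
      unfolding f_def using finU[OF that]
      by (intro jointly_bounded_power jointly_bounded_vanishing_poly) (auto simp: U_def bounded_mpoly_lform[simplified])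
    then have "bounded_mpoly n (card (U i) * ?q ^ j i - e) (coeff (f i) e)"
      using False unfolding jointly_bounded_def by blast
    moreover have "card (U i) * ?q ^ j i - e \<le> ?q ^ (k - 1)"
      using card[OF that] le[OF that] by linarith
    ultimately show ?thesis by (rule bounded_mpoly_mono)
  qed (simp add: bounded_mpoly_0)
  define M where "M = mat k k (\<lambda>(i, s). to_fract (coeff (f i) (?q ^ s)))"
  have M: "M \<in> carrier_mat k k" by (simp add: M_def)
  interpret h: comm_ring_hom "to_fract :: 'a mpoly \<Rightarrow> 'a ratfun" by (rule to_fract_hom)
  have "M = map_mat to_fract (mat k k (\<lambda>(i, s). coeff (f i) (?q ^ s)))"
    by (rule eq_matI) (auto simp: M_def)
  then have "det M = to_fract (det (mat k k (\<lambda>(i, s). coeff (f i) (?q ^ s))))" by simp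
  moreover have "det (mat k k (\<lambda>(i, s). coeff (f i) (?q ^ s))) \<noteq> 0"
    by (rule det_coeffs_neq_0) (use indep lin deg in \<open>auto simp: f_def\<close>)
  ultimately have "invertible_mat M" by (intro det_neq_0_imp_invertible[OF M]) simp
  moreover have "mat_of_row (row M i) * gab_matrix TYPE('a) k n * lift_mat (A i) = 0\<^sub>m 1 (dim_col (A i))"
    if i: "i < k" for i
  proof (rule eq_matI)
    fix r c assume rc: "r < dim_row (0\<^sub>m 1 (dim_col (A i)))" "c < dim_col (0\<^sub>m 1 (dim_col (A i)))"
    then have r: "r = 0" and c: "c < fq_dim n (V i)" using A(1)[OF i] by auto
    have "col (A i) c \<in> V i" using col_mem_col_span[OF A(1)[OF i] c] A(2)[OF i] by simp
    then have "lform n (col (A i) c) \<in> U i" by (simp add: U_def)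
    then have "poly (f i) (lform n (col (A i) c)) = 0"
      using finU[OF i] q by (simp add: f_def poly_vanishing_poly_eq_0)
    moreover have "(mat_of_row (row M i) * gab_matrix TYPE('a) k n * lift_mat (A i)) $$ (0, c) =
        to_fract (poly (f i) (lform n (col (A i) c)))"
      by (rule row_gab_lift_eq_poly[OF A(1)[OF i] c M i _ lin[OF i] deg[OF i]]) (simp add: M_def i)
    ultimately show "(mat_of_row (row M i) * gab_matrix TYPE('a) k n * lift_mat (A i)) $$ (r, c) =
        0\<^sub>m 1 (dim_col (A i)) $$ (r, c)" using rc r by simp
  qed (simp_all add: lift_mat_def mat_of_row_def)
  moreover have "\<exists>p. M $$ (i, s) = to_fract p \<and> vars p \<subseteq> {..<n} \<and> total_degree p \<le> ?q ^ (k - 1)"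
    if "i < k" "s < k" for i s
    using that bounded_mpoly_imp[OF bound[OF that(1)]]
    by (intro exI[of _ "coeff (f i) (?q ^ s)"]) (simp add: M_def)
  ultimately show ?thesis using M by blast
qed

section \<open>The MRD property\<close>

lemma vectorspace_fq_module: "vectorspace (class_ring :: 'a::field ring) (fq_module TYPE('a))"
proof -
  have emb: "emb (a + b) = emb a + emb b" "emb (a * b) = emb a * emb b" "emb 1 = 1" for a b :: 'a
    by (simp_all add: emb_def)
  interpret abelian_group "fq_module TYPE('a)"
  proof (rule abelian_groupI)
    fix x assume "x \<in> carrier (fq_module TYPE('a))"
    show "\<exists>y\<in>carrier (fq_module TYPE('a)). y \<oplus>\<^bsub>fq_module TYPE('a)\<^esub> x = \<zero>\<^bsub>fq_module TYPE('a)\<^esub>"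
      by (rule bexI[of _ "- x"]) (simp_all add: fq_module_def)
  qed (simp_all add: fq_module_def add_ac)
  have "Module.module (class_ring :: 'a ring) (fq_module TYPE('a))"
    by unfold_locales (simp_all add: fq_module_def class_ring_simps emb distrib_left distrib_right mult.assoc)
  then show ?thesis
    unfolding vectorspace_def using class_field[where 'a='a] by (simp add: class_field_def)
qed

text \<open>Turns the rank of a codeword into a cardinality, the form in which the counting argument
  for MRD uses it.\<close>

lemma fq_module_span:
  fixes S :: "'a::{finite,field} ratfun set"
  assumes "finite S"
  defines "W \<equiv> LinearCombinations.module.span (class_ring :: 'a ring) (fq_module TYPE('a)) S"
  shows "finite W" "card W = CARD('a) ^ vectorspace.dim (class_ring :: 'a ring) (fq_module TYPE('a)\<lparr>carrier := W\<rparr>)"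
    and "finite J \<Longrightarrow> (\<And>j. j \<in> J \<Longrightarrow> x j \<in> S) \<Longrightarrow> (\<Sum>j\<in>J. emb (c j) * x j) \<in> W"
proof -
  interpret V: vectorspace "class_ring :: 'a ring" "fq_module TYPE('a)" by (rule vectorspace_fq_module)
  have S: "S \<subseteq> carrier (fq_module TYPE('a))" by (simp add: fq_module_def)
  have "W \<subseteq> (\<lambda>a. V.lincomb a S) ` (S \<rightarrow>\<^sub>E UNIV)"
  proof
    fix w assume "w \<in> W"
    then obtain a where "w = V.lincomb a S" unfolding W_def V.finite_span[OF assms(1) S] by blast
    moreover have "V.lincomb (restrict a S) S = V.lincomb a S"
      unfolding V.lincomb_def using S by (intro V.finsum_cong') (auto simp: fq_module_def)
    ultimately show "w \<in> (\<lambda>a. V.lincomb a S) ` (S \<rightarrow>\<^sub>E UNIV)"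
      by (intro image_eqI[of _ _ "restrict a S"]) auto
  qed
  moreover have "finite (S \<rightarrow>\<^sub>E (UNIV :: 'a set))" using assms(1) by (intro finite_PiE) auto
  ultimately show fin: "finite W" using finite_surj by blast
  have sub: "VectorSpace.subspace (class_ring :: 'a ring) W (fq_module TYPE('a))"
    unfolding W_def by (rule V.span_is_subspace[OF S])
  show "card W = CARD('a) ^ vectorspace.dim (class_ring :: 'a ring) (fq_module TYPE('a)\<lparr>carrier := W\<rparr>)"
    using card_vectorspace[OF V.subspace_is_vs[OF sub]] fin by simp
  have "submodule (class_ring :: 'a ring) W (fq_module TYPE('a))"
    using sub unfolding VectorSpace.subspace_def by blast
  then interpret W: submodule "class_ring :: 'a ring" W "fq_module TYPE('a)" .
  have SW: "S \<subseteq> W" unfolding W_def by (rule V.in_own_span[OF S])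
  have scale: "emb c * v \<in> W" if "v \<in> W" for c v
    using W.smult_closed[of c v] that by (simp add: fq_module_def class_ring_simps)
  have add: "v + w \<in> W" if "v \<in> W" "w \<in> W" for v w
    using W.m_closed[of v w] that by (simp add: fq_module_def)
  have zero: "0 \<in> W" using W.zero_closed by (simp add: fq_module_def)
  show "(\<Sum>j\<in>J. emb (c j) * x j) \<in> W" if "finite J" "\<And>j. j \<in> J \<Longrightarrow> x j \<in> S"
    using that
  proof (induction J rule: finite_induct)
    case (insert j J)
    have "x j \<in> W" using insert.prems[of j] SW by auto
    then have "emb (c j) * x j + (\<Sum>j\<in>J. emb (c j) * x j) \<in> W"
      using insert by (intro add scale) auto
    then show ?case using insert.hyps by simp
  qed (simp add: zero)
qed

lemma card_le_card_image_mult: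
  assumes "finite A" "\<And>y. card {x \<in> A. f x = y} \<le> N"
  shows "card A \<le> card (f ` A) * N"
proof -
  have "A = (\<Union>y\<in>f ` A. {x \<in> A. f x = y})" by auto
  then have "card A \<le> (\<Sum>y\<in>f ` A. card {x \<in> A. f x = y})"
    using card_UN_le[of "f ` A" "\<lambda>y. {x \<in> A. f x = y}"] assms(1) by simp
  also have "\<dots> \<le> card (f ` A) * N" using sum_bounded_above[of "f ` A" _ N] assms(2) by simp
  finally show ?thesis .
qed

text \<open>The codeword of \<open>u\<close> consists of values of a linearized polynomial of degree at most \<open>q\<^sup>k\<^sup>-\<^sup>1\<close>,
  which attains each value at most \<open>q\<^sup>k\<^sup>-\<^sup>1\<close> times on the span of the variables.\<close>
lemma is_MRD_gab_matrix:
  assumes "1 \<le> k" "k \<le> n"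
  shows "is_MRD n k (gab_matrix TYPE('a::{finite,field}) k n)"
  unfolding is_MRD_def
proof (intro ballI impI)
  interpret h: comm_ring_hom "to_fract :: 'a mpoly \<Rightarrow> 'a ratfun" by (rule to_fract_hom)
  let ?q = "CARD('a)" and ?G = "gab_matrix TYPE('a) k n"
  have q: "1 < ?q" using card_UNIV_ge_2[where 'a='a] by simp
  fix v assume "v \<in> code_of n k ?G" and v0: "v \<noteq> 0\<^sub>v n"
  then obtain u where u: "u \<in> carrier_vec k" and v: "v = transpose_mat ?G *\<^sub>v u"
    unfolding code_of_def by blast
  have dim: "dim_vec v = n" by (simp add: v gab_matrix_def)
  have vj: "v $ j = (\<Sum>i<k. u $ i * to_fract (Zvar j ^ (?q ^ i)))" if "j < n" for j
    using that u by (simp add: v gab_matrix_def scalar_prod_def atLeast0LessThan mult.commute)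
  define f where "f = (\<Sum>i<k. monom (u $ i) (?q ^ i))"
  have coeff_f: "coeff f (?q ^ i) = u $ i" if "i < k" for i
    using that q by (simp add: f_def coeff_sum)
  have "\<exists>i<k. u $ i \<noteq> 0"
  proof (rule ccontr)
    assume "\<not> ?thesis"
    then have "v $ j = 0" if "j < n" for j using vj[OF that] by simp
    then have "v = 0\<^sub>v n" using dim by (intro eq_vecI) auto
    with v0 show False by simp
  qed
  then obtain i0 where i0: "i0 < k" "u $ i0 \<noteq> 0" by blast
  have deg: "degree f \<le> ?q ^ (k - 1)"
    unfolding f_def
  proof (rule degree_sum_le)
    fix i assume "i \<in> {..<k}"
    then have "?q ^ i \<le> ?q ^ (k - 1)" using q by (intro power_increasing) auto
    then show "degree (monom (u $ i) (?q ^ i)) \<le> ?q ^ (k - 1)"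
      using degree_monom_le order_trans by blast
  qed simp
  \<comment> \<open>All F_q-combinations of the codeword entries; these equal the values of
    \<open>f\<close> at the linear forms of \<open>x\<close>.\<close>
  define T where "T x = (\<Sum>j<n. emb (x $ j) * v $ j)" for x :: "'a vec"
  have T: "T x = poly f (to_fract (lform n x))" for x
  proof -
    have "T x = (\<Sum>j<n. \<Sum>i<k. u $ i * (emb (x $ j) * to_fract (Zvar j ^ (?q ^ i))))"
      unfolding T_def by (intro sum.cong) (simp_all add: vj sum_distrib_left mult.left_commute)
    also have "\<dots> = (\<Sum>i<k. u $ i * (\<Sum>j<n. emb (x $ j) * to_fract (Zvar j ^ (?q ^ i))))"
      by (subst sum.swap) (simp only: sum_distrib_left)
    also have "\<dots> = (\<Sum>i<k. u $ i * to_fract (lform n x ^ (?q ^ i)))"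
      by (simp only: lform_power_card emb_def to_fract_sum to_fract_mult)
    also have "\<dots> = poly f (to_fract (lform n x))"
      by (simp add: f_def poly_sum poly_monom h.hom_power)
    finally show ?thesis .
  qed
  have fibre: "card {x \<in> carrier_vec n. T x = y} \<le> ?q ^ (k - 1)" for y
  proof -
    let ?p = "f - [:y:]"
    \<comment> \<open>Subtracting the constant \<open>y\<close> changes only exponent 0, and q^i0 is
      positive, so the difference is nonzero for every \<open>y\<close>.\<close>
    have "coeff ?p (?q ^ i0) = u $ i0"
      using coeff_f[OF i0(1)] q by (simp add: coeff_pCons split: nat.split)
    then have p0: "?p \<noteq> 0" using i0(2) by (metis coeff_0)
    have "inj_on (\<lambda>x. to_fract (lform n x)) {x \<in> carrier_vec n. T x = y}"
      by (intro inj_onI) (auto dest!: inj_onD[OF inj_on_lform])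
    then have "card {x \<in> carrier_vec n. T x = y} \<le> card {z. poly ?p z = 0}"
      using T p0 by (intro card_inj_on_le[OF _ _ poly_roots_finite]) auto
    also have "\<dots> \<le> degree ?p" by (rule card_poly_roots_bound[OF p0])
    also have "\<dots> \<le> ?q ^ (k - 1)" using deg by (intro degree_diff_le) simp_all
    finally show ?thesis .
  qed
  define W where "W = LinearCombinations.module.span (class_ring :: 'a ring) (fq_module TYPE('a)) (set\<^sub>v v)"
  have fin: "finite (set\<^sub>v v)" by (simp add: vec_set_def)
  have "T ` carrier_vec n \<subseteq> W"
    unfolding T_def W_def using dim by (intro image_subsetI fq_module_span(3)[OF fin]) (auto simp: vec_set_def)
  then have "card (T ` carrier_vec n) \<le> card W"
    unfolding W_def by (intro card_mono fq_module_span(1)[OF fin])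
  also have "card W = ?q ^ fq_rank v"
    unfolding W_def fq_rank_def by (rule fq_module_span(2)[OF fin])
  finally have "card (T ` carrier_vec n) * ?q ^ (k - 1) \<le> ?q ^ (fq_rank v + (k - 1))"
    by (simp add: power_add)
  moreover have "?q ^ n \<le> card (T ` carrier_vec n) * ?q ^ (k - 1)"
    using card_le_card_image_mult[OF finite_carrier_vec fibre] by (simp add: card_carrier_vec)
  \<comment> \<open>The q^n vectors fall into at most q^rank fibres of size at most q^(k-1).\<close>
  ultimately have "?q ^ n \<le> ?q ^ (fq_rank v + (k - 1))" by linarith
  then have "n \<le> fq_rank v + (k - 1)" unfolding power_card_le_iff .
  then show "n - k + 1 \<le> fq_rank v" using assms by linarith
qed

lemma to_fract_mem_ratfun_field: "vars p \<subseteq> {..<n} \<Longrightarrow> to_fract p \<in> ratfun_field n"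
  unfolding ratfun_field_def to_fract_def
  by (intro CollectI exI[of _ p] exI[of _ 1]) (auto simp: vars_def)

theorem mainTheorem7:
  fixes k n :: nat
  assumes "1 \<le> k" and "k \<le> n"
  defines "G \<equiv> gab_matrix TYPE('a::{finite,field}) k n"
  shows "(\<forall>V A. generic_kernel_pattern n k V \<longrightarrow>
            (\<forall>i<k. A i \<in> carrier_mat n (fq_dim n (V i)) \<and> col_span n (A i) = V i) \<longrightarrow>
            (\<exists>M \<in> carrier_mat k k.
                invertible_mat M \<and>
                (\<forall>i<k. mat_of_row (row M i) * G * lift_mat (A i) = 0\<^sub>m 1 (dim_col (A i))) \<and>
                (\<forall>i<k. \<forall>j<k. \<exists>p. M $$ (i,j) = to_fract p \<and> vars p \<subseteq> {..<n} \<and>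
                                  total_degree p \<le> card (UNIV :: 'a set) ^ (k - 1))))
       \<and> (\<forall>l\<ge>1. is_GKP l n k G)"
proof (intro conjI allI impI)
  fix V :: "nat \<Rightarrow> 'a vec set" and A
  assume "generic_kernel_pattern n k V"
    and "\<forall>i<k. A i \<in> carrier_mat n (fq_dim n (V i)) \<and> col_span n (A i) = V i"
  then show "\<exists>M \<in> carrier_mat k k. invertible_mat M \<and>
      (\<forall>i<k. mat_of_row (row M i) * G * lift_mat (A i) = 0\<^sub>m 1 (dim_col (A i))) \<and>
      (\<forall>i<k. \<forall>j<k. \<exists>p. M $$ (i,j) = to_fract p \<and> vars p \<subseteq> {..<n} \<and>
         total_degree p \<le> card (UNIV :: 'a set) ^ (k - 1))"
    unfolding G_def by (intro gab_attains_pattern) auto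
next
  fix l :: nat
  have "attains n k G V" if gen: "generic_kernel_pattern n k V" for V :: "nat \<Rightarrow> 'a vec set"
    unfolding attains_def
  proof (intro allI impI)
    fix A assume A: "\<forall>i<k. A i \<in> carrier_mat n (fq_dim n (V i)) \<and> col_span n (A i) = V i"
    obtain M where M: "M \<in> carrier_mat k k" "invertible_mat M"
      "\<forall>i<k. mat_of_row (row M i) * G * lift_mat (A i) = 0\<^sub>m 1 (dim_col (A i))"
      "\<forall>i<k. \<forall>j<k. \<exists>p. M $$ (i,j) = to_fract p \<and> vars p \<subseteq> {..<n} \<and> total_degree p \<le> CARD('a) ^ (k - 1)"
      using gab_attains_pattern[OF gen, of A] A unfolding G_def by blast
    \<comment> \<open>The entries come from the original spaces only; fresh variables influenced the
      choice of exponents but never enter \<open>M\<close>, so the first n variables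
      suffice.\<close>
    have "in_F_mat n M"
      unfolding in_F_mat_def
    proof (intro allI impI)
      fix i j assume "i < dim_row M" "j < dim_col M"
      then have "i < k" "j < k" using M(1) by auto
      then obtain p where "M $$ (i,j) = to_fract p" "vars p \<subseteq> {..<n}" using M(4) by blast
      then show "M $$ (i,j) \<in> ratfun_field n" by (simp add: to_fract_mem_ratfun_field)
    qed
    with M(1-3) show "\<exists>M\<in>carrier_mat k k. in_F_mat n M \<and> invertible_mat M \<and>
        (\<forall>i<k. mat_of_row (row M i) * G * lift_mat (A i) = 0\<^sub>m 1 (dim_col (A i)))" by blast
  qed
  then show "is_GKP l n k G"
    unfolding is_GKP_def using is_MRD_gab_matrix[OF assms(1,2)] by (simp add: G_def)
qed

end
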